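(* Let $L$ be a Lelek fan with top $v$, and let $\mathcal L(L)$ be the set of legs of $L$. Then for each leg $A\in\mathcal L(L)$ there is a Cantor fan $C_A\subseteq L$ such that: - for all $A_1,A_2\in\mathcal L(L)$ with $A_1\neq A_2$ we have $C_{A_1}\cap C_{A_2}=\{v\}$; - $\bigcup_{A\in\mathcal L(L)}C_A=L$.
   Context: A continuum is a nonempty compact connected metric space. A dendroid is an arcwise connected, hereditarily unicoherent continuum. A point $x$ of a dendroid $X$ is a ramification point if $x$ is the top (the branch point) of some simple triod in $X$. A fan is a dendroid with at most one ramification point; this point, if it exists, is called the top of the fan. For a fan $X$, a point $x$ is an end point of $X$ if $x$ is an end point of every arc in $X$ containing $x$; $E(X)$ denotes the set of end points of $X$. For a fan $X$ with top $v$, a leg of $X$ is the arc from $v$ to an end point $e\in E(X)$, and $\mathcal L(X)$ denotes the set of legs. A fan $X$ with top $v$ is smooth if for every $x\in X$ and every sequence $x_n\to x$ in $X$, the arcs from $v$ to $x_n$ converge (in the Hausdorff metric) to the arc from $v$ to $x$. A Lelek fan is a smooth fan $X$ with $\mathrm{Cl}(E(X))=X$. A Cantor fan is a continuum homeomorphic to $\bigcup_{c\in C}A_c\subseteq\mathbb R^2$, where $C\subseteq[0,1]$ is the Cantor middle-third set and $A_c$ is the straight segment from $(\tfrac12,0)$ to $(c,1)$. *)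

theory Defs
  imports "HOL-Analysis.Analysis"
begin

definition continuum :: "'a::metric_space set \<Rightarrow> bool" where
  "continuum X \<longleftrightarrow> X \<noteq> {} \<and> compact X \<and> connected X"

definition arc_from_to :: "'a::metric_space set \<Rightarrow> 'a \<Rightarrow> 'a \<Rightarrow> 'a set \<Rightarrow> bool" where
  "arc_from_to X x y A \<longleftrightarrow> A \<subseteq> X \<and>
     (\<exists>g. arc g \<and> path_image g = A \<and> pathstart g = x \<and> pathfinish g = y)"

definition arcwise_connected :: "'a::metric_space set \<Rightarrow> bool" where
  "arcwise_connected X \<longleftrightarrow> (\<forall>x\<in>X. \<forall>y\<in>X. x \<noteq> y \<longrightarrow> (\<exists>A. arc_from_to X x y A))"

definition hereditarily_unicoherent :: "'a::metric_space set \<Rightarrow> bool" where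
  "hereditarily_unicoherent X \<longleftrightarrow>
     (\<forall>P Q. P \<subseteq> X \<and> Q \<subseteq> X \<and> continuum P \<and> continuum Q \<longrightarrow> connected (P \<inter> Q))"

definition dendroid :: "'a::metric_space set \<Rightarrow> bool" where
  "dendroid X \<longleftrightarrow> continuum X \<and> arcwise_connected X \<and> hereditarily_unicoherent X"

definition ramification_point :: "'a::metric_space set \<Rightarrow> 'a \<Rightarrow> bool" where
  "ramification_point X x \<longleftrightarrow>
     (\<exists>A1 A2 A3 y1 y2 y3. arc_from_to X x y1 A1 \<and> arc_from_to X x y2 A2 \<and> arc_from_to X x y3 A3 \<and>
        A1 \<inter> A2 = {x} \<and> A1 \<inter> A3 = {x} \<and> A2 \<inter> A3 = {x})"

definition fan :: "'a::metric_space set \<Rightarrow> bool" where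
  "fan X \<longleftrightarrow> dendroid X \<and> (\<forall>x y. ramification_point X x \<and> ramification_point X y \<longrightarrow> x = y)"

definition end_point_of_arc :: "'a::metric_space \<Rightarrow> 'a set \<Rightarrow> bool" where
  "end_point_of_arc x A \<longleftrightarrow>
     (\<exists>g. arc g \<and> path_image g = A \<and> (pathstart g = x \<or> pathfinish g = x))"

definition is_arc :: "'a::metric_space set \<Rightarrow> bool" where
  "is_arc A \<longleftrightarrow> (\<exists>g. arc g \<and> path_image g = A)"

definition end_points :: "'a::metric_space set \<Rightarrow> 'a set" where
  "end_points X = {x \<in> X. \<forall>A. A \<subseteq> X \<and> is_arc A \<and> x \<in> A \<longrightarrow> end_point_of_arc x A}"

definition vx_segment :: "'a::metric_space set \<Rightarrow> 'a \<Rightarrow> 'a \<Rightarrow> 'a set \<Rightarrow> bool" where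
  "vx_segment X v x A \<longleftrightarrow> (x = v \<and> A = {v}) \<or> (x \<noteq> v \<and> arc_from_to X v x A)"

definition legs :: "'a::metric_space set \<Rightarrow> 'a \<Rightarrow> 'a set set" where
  "legs X v = {A. \<exists>e\<in>end_points X. vx_segment X v e A}"

definition hausdist :: "'a::metric_space set \<Rightarrow> 'a set \<Rightarrow> real" where
  "hausdist A B = max (SUP a\<in>A. infdist a B) (SUP b\<in>B. infdist b A)"

text \<open>Smoothness with respect to the top v: arcs [v,x_n] converge in the Hausdorff metric
  to [v,x] whenever x_n \<rightarrow> x (in a dendroid these arcs are unique).\<close>
definition smooth_fan :: "'a::metric_space set \<Rightarrow> 'a \<Rightarrow> bool" where
  "smooth_fan X v \<longleftrightarrow>
     (\<forall>x xs A As. x \<in> X \<and> (\<forall>n. xs n \<in> X) \<and> xs \<longlonglongrightarrow> x \<and>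
        vx_segment X v x A \<and> (\<forall>n. vx_segment X v (xs n) (As n))
        \<longrightarrow> (\<lambda>n. hausdist (As n) A) \<longlonglongrightarrow> 0)"

definition lelek_fan :: "'a::metric_space set \<Rightarrow> 'a \<Rightarrow> bool" where
  "lelek_fan X v \<longleftrightarrow> fan X \<and> ramification_point X v \<and> smooth_fan X v \<and>
     closure (end_points X) = X"

definition cantor_set :: "real set" where
  "cantor_set = {x. \<exists>d::nat \<Rightarrow> nat. (\<forall>n. d n \<in> {0, 2}) \<and> x = (\<Sum>n. real (d n) / 3 ^ (n + 1))}"

definition standard_cantor_fan :: "(real \<times> real) set" where
  "standard_cantor_fan = (\<Union>c\<in>cantor_set. closed_segment (1/2, 0) (c, 1))"

definition cantor_fan :: "'a::metric_space set \<Rightarrow> bool" where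
  "cantor_fan C \<longleftrightarrow> C homeomorphic standard_cantor_fan"

end

theory Submission
  imports Defs
begin

text \<open>
  Order the fan by \<open>x \<le> y\<close> iff \<open>x\<close> lies on the arc from
  \<open>v\<close> to \<open>y\<close>. The end points are the maximal points, and for a Cantor set
  \<open>K\<close> of end points smoothness makes the union of the legs ending in \<open>K\<close> a
  Cantor fan. So it suffices to partition the set \<open>E\<close> of end points into Cantor sets,
  one for each point of \<open>E\<close>. By smoothness \<open>E\<close> is a
  \<open>G\<^sub>\<delta>\<close>, and by density of \<open>E\<close> it is nowhere locally compact,
  hence there are countably many disjoint Cantor sets \<open>Q\<^sub>n \<subseteq> E\<close>, one in
  each member of a base. Writing \<open>Q\<^sub>n\<close> as a product of two Cantor spaces cuts it
  into Cantor slices labelled by the Cantor space. Give the points of \<open>E -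
  \<Union>Q\<^sub>n\<close> distinct labels and add to each of them a sequence of slices with its
  label converging to it; this is a Cantor set. The slices left over are the other members of the
  partition. Slicing every member once more yields as many pieces as it has points.
\<close>

subsection \<open>Arcs\<close>

text \<open>The obstacle is the remainder \<open>E - \<Union>Q\<^sub>n\<close>: it may be
  uncountable, while only countably many \<open>Q\<^sub>n\<close> can be shared out, and each of its
  points needs infinitely many Cantor pieces shrinking to it. Slicing resolves this, since one
  \<open>Q\<^sub>n\<close> offers a slice for every label: points with different labels can draw on
  the same \<open>Q\<^sub>n\<close> without conflict. As label of a point serves the boolean
  sequence telling which members of the base contain it. The two properties of \<open>E\<close> have
  separate uses. A Cantor scheme has its limits in the compact fan only; stepping around one of the
  closed sets of the \<open>G\<^sub>\<delta>\<close> representation at each stage moves them into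
  \<open>E\<close>. Nowhere local compactness guarantees that the finitely many Cantor sets already
  chosen never exhaust \<open>E\<close> inside a base member, so that the next one can be chosen
  disjoint from them. The last slicing replaces a cardinality argument: the parametrization of a
  member labels its points and its slices alike, which gives the bijection of end points with pieces
  explicitly.\<close>

lemma in_path_image: "0 \<le> t \<Longrightarrow> t \<le> 1 \<Longrightarrow> g t \<in> path_image g"
  by (simp add: path_image_def)

lemma arc_eq_iff:
  "\<lbrakk>arc g; 0 \<le> s; s \<le> 1; 0 \<le> t; t \<le> 1\<rbrakk> \<Longrightarrow> g s = g t \<longleftrightarrow> s = t"
  by (auto simp: arc_def inj_on_def)

lemma arc_subarc:
  fixes g :: "real \<Rightarrow> 'a::topological_space"
  assumes "arc g" "0 \<le> a" "a < b" "b \<le> 1"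
  obtains k where "arc k" "path_image k = g ` {a..b}" "pathstart k = g a" "pathfinish k = g b"
proof
  let ?k = "g \<circ> (\<lambda>x. (b - a) * x + a)"
  have img: "(\<lambda>x. (b - a) * x + a) ` {0..1} = {a..b}"
    using assms(3) by (auto simp: image_affinity_atLeastAtMost)
  have sub: "{a..b} \<subseteq> {0..1}"
    using assms by auto
  have "continuous_on {0..1} ?k"
    using assms(1) sub unfolding arc_def path_def
    by (intro continuous_on_compose continuous_intros) (auto simp: img intro: continuous_on_subset)
  moreover have "inj_on ?k {0..1}"
  proof (rule comp_inj_on)
    show "inj_on (\<lambda>x. (b - a) * x + a) {0..1}"
      using assms(3) by (auto simp: inj_on_def)
    show "inj_on g ((\<lambda>x. (b - a) * x + a) ` {0..1})"
      using assms(1) sub unfolding img arc_def by (meson inj_on_subset)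
  qed
  ultimately show "arc ?k"
    by (simp add: arc_def path_def)
  show "path_image ?k = g ` {a..b}"
    unfolding path_image_def image_comp[symmetric] img ..
  show "pathstart ?k = g a" "pathfinish ?k = g b"
    by (simp_all add: pathstart_def pathfinish_def)
qed

text \<open>The inverse of the parametrization carries \<open>T\<close> to a connected set of reals,
  that is, to an interval.\<close>

lemma connected_subset_arc_convex:
  fixes g :: "real \<Rightarrow> 'a::t2_space"
  assumes g: "arc g" and T: "connected T" "T \<subseteq> path_image g"
    and st: "g s \<in> T" "g t \<in> T" "0 \<le> s" "s \<le> u" "u \<le> t" "t \<le> 1"
  shows "g u \<in> T"
proof -
  obtain h where h: "homeomorphism {0..1} (path_image g) g h"
    using homeomorphism_arc[OF g] .
  have "connected (h ` T)"
    using T h by (meson connected_continuous_image continuous_on_subset homeomorphism_cont2)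
  moreover have "s \<in> h ` T" "t \<in> h ` T"
    using st h by (force simp: homeomorphism_def image_iff)+
  ultimately have "u \<in> h ` T"
    using st connected_contains_Icc[of "h ` T" s t] by auto
  then show ?thesis
    using T h by (auto simp: homeomorphism_def)
qed

text \<open>An arc stays connected when an end point is removed, but not when an interior point
  is.\<close>

lemma not_end_point_of_arc_interior:
  fixes g :: "real \<Rightarrow> 'a::metric_space"
  assumes g: "arc g" and t: "0 < t" "t < 1"
  shows "\<not> end_point_of_arc (g t) (path_image g)"
proof
  assume "end_point_of_arc (g t) (path_image g)"
  then obtain k where k: "arc k" "path_image k = path_image g" "pathstart k = g t"
    unfolding end_point_of_arc_def
    by (metis arc_reversepath path_image_reversepath pathstart_reversepath)
  have "path_image k - {k 0} = k ` {0<..1}"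
  proof -
    have "{0..1} = insert 0 {0<..(1::real)}"
      by auto
    then show ?thesis
      using arc_imp_inj_on[OF k(1)] by (auto simp: path_image_def inj_on_def)
  qed
  moreover have "connected (k ` {0<..1})"
    by (rule connected_continuous_image)
      (use k(1) in \<open>auto simp: arc_def path_def intro: continuous_on_subset\<close>)
  ultimately have conn: "connected (path_image g - {g t})"
    using k by (simp add: pathstart_def)
  have "g 0 \<noteq> g t" "g 1 \<noteq> g t"
    using t by (simp_all add: arc_eq_iff[OF g])
  then have "g t \<in> path_image g - {g t}"
    by (intro connected_subset_arc_convex[OF g conn, of 0 1 t]) (use t in \<open>auto simp: path_image_def\<close>)
  then show False
    by simp
qed

subsection \<open>The order of a fan\<close>

locale pointed_fan =
  fixes L :: "'a::metric_space set" and v :: 'a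
  assumes fan: "fan L" and top: "ramification_point L v"
begin

lemma compact_L: "compact L"
  using fan by (simp add: fan_def dendroid_def continuum_def)

lemma ramification_point_unique: "ramification_point L x \<Longrightarrow> x = v"
  using fan top by (simp add: fan_def)

lemma connected_Int_continua:
  "\<lbrakk>P \<subseteq> L; Q \<subseteq> L; continuum P; continuum Q\<rbrakk> \<Longrightarrow> connected (P \<inter> Q)"
  using fan by (simp add: fan_def dendroid_def hereditarily_unicoherent_def)

lemma continuum_arc: "arc g \<Longrightarrow> continuum (path_image g)"
  by (simp add: continuum_def compact_arc_image connected_arc_image)

text \<open>Hereditary unicoherence makes \<open>A \<inter> B\<close> connected; containing both
  ends of either arc, it is all of each.\<close>

lemma arc_from_to_unique:
  assumes "arc_from_to L x y A" "arc_from_to L x y B"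
  shows "A = B"
proof -
  have "A \<subseteq> B" if A: "arc_from_to L x y A" and B: "arc_from_to L x y B" for A B
  proof -
    obtain g where g: "arc g" "path_image g = A" "g 0 = x" "g 1 = y" "A \<subseteq> L"
      using A by (auto simp: arc_from_to_def pathstart_def pathfinish_def)
    obtain k where k: "arc k" "path_image k = B" "k 0 = x" "k 1 = y" "B \<subseteq> L"
      using B by (auto simp: arc_from_to_def pathstart_def pathfinish_def)
    have conn: "connected (A \<inter> B)"
      using connected_Int_continua continuum_arc g k by blast
    have "x \<in> A \<inter> B" "y \<in> A \<inter> B"
      using g k in_path_image[of 0 g] in_path_image[of 1 g] in_path_image[of 0 k] in_path_image[of 1 k]
      by force+
    then have "g u \<in> A \<inter> B" if "u \<in> {0..1}" for u
      using that g connected_subset_arc_convex[OF g(1) conn, of 0 1 u] by auto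
    then show ?thesis
      using g(2) by (auto simp: path_image_def)
  qed
  then show ?thesis
    using assms by blast
qed

lemma top_in: "v \<in> L"
proof -
  obtain y A where "arc_from_to L v y A"
    using top by (auto simp: ramification_point_def)
  then show ?thesis
    by (metis arc_from_to_def pathstart_in_path_image subsetD)
qed

text \<open>The arc from the top to \<open>x\<close>, degenerate for \<open>x = v\<close>. The order
  of the overview is the relation \<open>x \<in> seg y\<close>.\<close>

definition seg :: "'a \<Rightarrow> 'a set" where
  "seg x = (THE A. vx_segment L v x A)"

lemma vx_segment_iff: "x \<in> L \<Longrightarrow> vx_segment L v x A \<longleftrightarrow> A = seg x"
proof -
  assume x: "x \<in> L"
  have "\<exists>A. vx_segment L v x A"
    using fan x top_in unfolding vx_segment_def fan_def dendroid_def arcwise_connected_def by metis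
  moreover have "A = B" if "vx_segment L v x A" "vx_segment L v x B" for A B
    using that arc_from_to_unique by (auto simp: vx_segment_def)
  ultimately have "\<exists>!A. vx_segment L v x A"
    by blast
  then show ?thesis
    unfolding seg_def by (metis the_equality)
qed

lemma seg_top [simp]: "seg v = {v}"
  using vx_segment_iff[OF top_in] by (simp add: vx_segment_def)

lemma seg_eqI:
  assumes "arc g" "path_image g \<subseteq> L" "pathstart g = v"
  shows "seg (pathfinish g) = path_image g"
proof -
  have "pathfinish g \<in> L"
    using assms by blast
  moreover have "vx_segment L v (pathfinish g) (path_image g)"
    using assms arc_distinct_ends[of g] by (auto simp: vx_segment_def arc_from_to_def)
  ultimately show ?thesis
    by (simp add: vx_segment_iff)
qed

text \<open>A parametrization identifies the order on one arc with that of the unit interval;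
  linearity, monotonicity and antisymmetry of \<open>seg\<close> then become statements about
  parameters.\<close>

lemma seg_param:
  assumes "x \<in> L" "x \<noteq> v"
  obtains g where "arc g" "path_image g = seg x" "seg x \<subseteq> L" "g 0 = v" "g 1 = x"
    "\<And>t. 0 \<le> t \<Longrightarrow> t \<le> 1 \<Longrightarrow> seg (g t) = g ` {0..t}"
proof -
  have "vx_segment L v x (seg x)"
    using assms vx_segment_iff by blast
  then obtain g where g: "arc g" "path_image g = seg x" "seg x \<subseteq> L" "g 0 = v" "g 1 = x"
    using assms by (auto simp: vx_segment_def arc_from_to_def pathstart_def pathfinish_def)
  have "seg (g t) = g ` {0..t}" if t: "0 \<le> t" "t \<le> 1" for t
  proof (cases "t = 0")
    case True
    then show ?thesis
      using g by simp
  next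
    case False
    then obtain k where k: "arc k" "path_image k = g ` {0..t}" "pathstart k = g 0" "pathfinish k = g t"
      using t by (auto intro: arc_subarc[OF g(1), of 0 t])
    have "g ` {0..t} \<subseteq> L"
      using g(2,3) t by (auto simp: path_image_def)
    then show ?thesis
      using seg_eqI[of k] k g by simp
  qed
  then show ?thesis
    using that g by blast
qed

lemma seg_arc:
  assumes "x \<in> L" "x \<noteq> v"
  obtains g where "arc g" "path_image g = seg x" "seg x \<subseteq> L" "g 0 = v" "g 1 = x"
  by (rule seg_param[OF assms]) (rule that)

lemma seg_subset: "x \<in> L \<Longrightarrow> seg x \<subseteq> L"
  by (cases "x = v") (simp add: top_in, erule (1) seg_arc)

lemma top_in_seg:
  assumes "x \<in> L"
  shows "v \<in> seg x"
proof (cases "x = v")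
  case False
  then obtain g where "path_image g = seg x" "g 0 = v"
    using seg_arc[OF assms False] by metis
  then show ?thesis
    using in_path_image[of 0 g] by simp
qed simp

lemma self_in_seg:
  assumes "x \<in> L"
  shows "x \<in> seg x"
proof (cases "x = v")
  case False
  obtain g where g: "path_image g = seg x" "g 1 = x"
    using seg_arc[OF assms False] by metis
  show ?thesis
    using in_path_image[of 1 g] unfolding g by simp
qed simp

lemma continuum_seg:
  assumes "x \<in> L"
  shows "continuum (seg x)"
proof (cases "x = v")
  case False
  then obtain g where "arc g" "path_image g = seg x"
    using seg_arc[OF assms False] by metis
  then show ?thesis
    using continuum_arc by metis
qed (simp add: continuum_def)

lemma compact_seg: "x \<in> L \<Longrightarrow> compact (seg x)"
  and connected_seg: "x \<in> L \<Longrightarrow> connected (seg x)"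
  using continuum_seg by (simp_all add: continuum_def)

lemma seg_linear:
  assumes "x \<in> L" "y \<in> seg x" "z \<in> seg x"
  shows "y \<in> seg z \<or> z \<in> seg y"
proof (cases "x = v")
  case False
  obtain g where g: "path_image g = seg x"
    "\<And>t. 0 \<le> t \<Longrightarrow> t \<le> 1 \<Longrightarrow> seg (g t) = g ` {0..t}"
    using seg_param[OF assms(1) False] by metis
  obtain s t where "y = g s" "z = g t" "0 \<le> s" "s \<le> 1" "0 \<le> t" "t \<le> 1"
    using assms(2,3) unfolding g(1)[symmetric] path_image_def by auto
  then show ?thesis
    using g(2)[of s] g(2)[of t] by (cases "s \<le> t") auto
qed (use assms in auto)

lemma seg_mono:
  assumes "x \<in> L" "y \<in> seg x"
  shows "seg y \<subseteq> seg x"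
proof (cases "x = v")
  case False
  obtain g where g: "path_image g = seg x"
    "\<And>t. 0 \<le> t \<Longrightarrow> t \<le> 1 \<Longrightarrow> seg (g t) = g ` {0..t}"
    using seg_param[OF assms(1) False] by metis
  then obtain t where "y = g t" "0 \<le> t" "t \<le> 1"
    using assms(2) unfolding g(1)[symmetric] path_image_def by auto
  then show ?thesis
    using g(2)[of t] unfolding g(1)[symmetric] path_image_def by auto
qed (use assms in auto)

lemma seg_antisym:
  assumes "x \<in> L" "y \<in> seg x" "x \<in> seg y"
  shows "x = y"
proof (cases "x = v")
  case False
  obtain g where g: "arc g" "path_image g = seg x" "g 1 = x"
    "\<And>t. 0 \<le> t \<Longrightarrow> t \<le> 1 \<Longrightarrow> seg (g t) = g ` {0..t}"
    using seg_param[OF assms(1) False] by metis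
  then obtain t where t: "y = g t" "0 \<le> t" "t \<le> 1"
    using assms(2) unfolding g(2)[symmetric] path_image_def by auto
  then obtain s where s: "0 \<le> s" "s \<le> t" "g s = g 1"
    using g assms(3) by auto
  then have "s = 1"
    using arc_imp_inj_on[OF g(1)] t by (auto simp: inj_on_def)
  then show ?thesis
    using s t g by auto
qed (use assms in auto)

text \<open>If neither point lay below the other, the last common point of the two arcs would be
  a second ramification point.\<close>

lemma seg_linear_above:
  assumes y: "y \<in> L" and z: "z \<in> L" and x: "x \<noteq> v" "x \<in> seg y" "x \<in> seg z"
  shows "y \<in> seg z \<or> z \<in> seg y"
proof (rule ccontr)
  assume neg: "\<not> ?thesis"
  have "y \<noteq> v" "z \<noteq> v"
    using x by auto
  obtain g where g: "arc g" "path_image g = seg y" "seg y \<subseteq> L" "g 0 = v" "g 1 = y"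
    "\<And>t. 0 \<le> t \<Longrightarrow> t \<le> 1 \<Longrightarrow> seg (g t) = g ` {0..t}"
    using seg_param[OF y \<open>y \<noteq> v\<close>] by metis
  obtain k where k: "arc k" "path_image k = seg z" "seg z \<subseteq> L" "k 0 = v" "k 1 = z"
    "\<And>t. 0 \<le> t \<Longrightarrow> t \<le> 1 \<Longrightarrow> seg (k t) = k ` {0..t}"
    using seg_param[OF z \<open>z \<noteq> v\<close>] by metis
  have conn: "connected (seg y \<inter> seg z)"
    using connected_Int_continua continuum_seg seg_subset y z by blast
  define S where "S = {t \<in> {0..1}. g t \<in> seg z}"
  have "closed S"
  proof -
    have "closed ({0..1} \<inter> g -` seg z)"
      using g(1) compact_seg[OF z]
      by (intro continuous_closed_preimage) (auto simp: arc_def path_def compact_imp_closed)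
    then show ?thesis
      by (simp add: S_def Int_def vimage_def)
  qed
  moreover have "S \<noteq> {}" "bdd_above S"
    using top_in_seg[OF z] g(4) unfolding S_def by force+
  ultimately have sS: "Sup S \<in> S"
    using closed_contains_Sup by blast
  define s where "s = Sup S"
  have s: "0 \<le> s" "s \<le> 1" "g s \<in> seg z"
    using sS by (auto simp: S_def s_def)
  have above: "t \<le> s" if "0 \<le> t" "t \<le> 1" "g t \<in> seg z" for t
    unfolding s_def using that \<open>bdd_above S\<close> by (intro cSup_upper) (auto simp: S_def)
  have "s \<noteq> 1"
    using neg s(3) g(5) by auto
  obtain tx where tx: "0 \<le> tx" "tx \<le> 1" "x = g tx"
    using x(2) unfolding g(2)[symmetric] path_image_def by auto
  have "s \<noteq> 0"
    using above[of tx] tx x g(4) by (cases "tx = 0") auto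
  obtain s' where s': "0 \<le> s'" "s' \<le> 1" "g s = k s'"
    using s(3) unfolding k(2)[symmetric] path_image_def by auto
  have injg: "inj_on g {0..1}" and injk: "inj_on k {0..1}"
    using g(1) k(1) by (auto simp: arc_def)
  have "g s \<noteq> v"
    using injg s \<open>s \<noteq> 0\<close> g(4) by (metis atLeastAtMost_iff inj_onD order_refl zero_le_one)
  have "s' \<noteq> 1"
  proof
    assume "s' = 1"
    then have "z \<in> seg y"
      using s' k(5) in_path_image[OF s(1,2), of g] g(2) by simp
    with neg show False
      by blast
  qed
  obtain a where a: "arc a" "path_image a = g ` {0..s}" "pathstart a = g 0" "pathfinish a = g s"
    by (rule arc_subarc[OF g(1), of 0 s]) (use s \<open>s \<noteq> 0\<close> in auto)
  obtain b where b: "arc b" "path_image b = g ` {s..1}" "pathstart b = g s" "pathfinish b = g 1"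
    by (rule arc_subarc[OF g(1), of s 1]) (use s \<open>s \<noteq> 1\<close> in auto)
  obtain c where c: "arc c" "path_image c = k ` {s'..1}" "pathstart c = k s'" "pathfinish c = k 1"
    by (rule arc_subarc[OF k(1), of s' 1]) (use s' \<open>s' \<noteq> 1\<close> in auto)
  \<comment> \<open>Both sides are \<open>seg (g s)\<close>: up to the branching point the two arcs
    agree, so a single arm leads back to \<open>v\<close>.\<close>
  have below: "g ` {0..s} = k ` {0..s'}"
    using g(6)[of s] k(6)[of s'] s s' by simp
  have sub: "g ` {0..s} \<subseteq> L" "g ` {s..1} \<subseteq> L" "k ` {s'..1} \<subseteq> L"
    using g(2,3) k(2,3) s s' by (auto simp: path_image_def)
  have "arc_from_to L (g s) v (g ` {0..s})"
    unfolding arc_from_to_def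
    by (intro conjI exI[of _ "reversepath a"]) (simp_all add: arc_reversepath sub a g)
  moreover have "arc_from_to L (g s) y (g ` {s..1})"
    unfolding arc_from_to_def
    by (intro conjI exI[of _ b]) (simp_all add: sub b g)
  moreover have "arc_from_to L (g s) z (k ` {s'..1})"
    unfolding arc_from_to_def
    by (intro conjI exI[of _ c]) (simp_all add: sub c k s')
  moreover have "g ` {0..s} \<inter> g ` {s..1} = {g s}"
  proof -
    have "g ` {0..s} \<inter> g ` {s..1} = g ` ({0..s} \<inter> {s..1})"
      using s by (intro inj_on_image_Int[OF injg, symmetric]) auto
    moreover have "{0..s} \<inter> {s..1} = {s}"
      using s by auto
    ultimately show ?thesis
      by simp
  qed
  moreover have "g ` {0..s} \<inter> k ` {s'..1} = {g s}"
  proof -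
    have "k ` {0..s'} \<inter> k ` {s'..1} = k ` ({0..s'} \<inter> {s'..1})"
      using s' by (intro inj_on_image_Int[OF injk, symmetric]) auto
    moreover have "{0..s'} \<inter> {s'..1} = {s'}"
      using s' by auto
    ultimately show ?thesis
      using s' below by simp
  qed
  moreover have "g ` {s..1} \<inter> k ` {s'..1} = {g s}"
  proof (intro equalityI subsetI)
    fix p assume "p \<in> g ` {s..1} \<inter> k ` {s'..1}"
    then obtain t r where t: "s \<le> t" "t \<le> 1" "p = g t" and r: "s' \<le> r" "r \<le> 1" "p = k r"
      by auto
    then have "p \<in> seg z"
      using s'(1) in_path_image[of r k] k(2) by simp
    then have "t = s"
      using above[of t] s t by auto
    then show "p \<in> {g s}"
      using t by simp
  next
    fix p assume "p \<in> {g s}"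
    then show "p \<in> g ` {s..1} \<inter> k ` {s'..1}"
      using imageI[of s "{s..1}" g] imageI[of s' "{s'..1}" k] s s' by simp
  qed
  ultimately have "ramification_point L (g s)"
    unfolding ramification_point_def
    by (intro exI[of _ "g ` {0..s}"] exI[of _ "g ` {s..1}"] exI[of _ "k ` {s'..1}"]
        exI[of _ v] exI[of _ y] exI[of _ z] conjI)
  then show False
    using ramification_point_unique \<open>g s \<noteq> v\<close> by simp
qed

section \<open>End points as maximal elements\<close>

lemma arc_interior_not_end_point:
  assumes "arc g" "path_image g \<subseteq> L" "0 < t" "t < 1"
  shows "g t \<notin> end_points L"
proof
  assume "g t \<in> end_points L"
  moreover have "is_arc (path_image g)" "g t \<in> path_image g"
    using assms by (auto simp: is_arc_def path_image_def)
  ultimately show False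
    using not_end_point_of_arc_interior[OF assms(1,3,4)] assms(2) by (auto simp: end_points_def)
qed

text \<open>Two arms of a triod at \<open>v\<close> join to an arc that has \<open>v\<close> in its
  interior, at parameter 1/2.\<close>

lemma top_not_end_point: "v \<notin> end_points L"
proof -
  obtain A1 A2 y1 y2 where "arc_from_to L v y1 A1" "arc_from_to L v y2 A2" "A1 \<inter> A2 = {v}"
    using top unfolding ramification_point_def by blast
  then obtain g k where g: "arc g" "path_image g = A1" "pathstart g = v" "A1 \<subseteq> L"
    and k: "arc k" "path_image k = A2" "pathstart k = v" "A2 \<subseteq> L" and Int: "A1 \<inter> A2 = {v}"
    by (auto simp: arc_from_to_def)
  let ?j = "reversepath g +++ k"
  have "arc ?j"
    using g k Int by (intro arc_join) (auto simp: arc_reversepath)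
  moreover have "path_image ?j \<subseteq> L"
    using path_image_join_subset[of "reversepath g" k] g k by auto
  moreover have "?j (1/2) = v"
    using g by (simp add: joinpaths_def reversepath_def pathstart_def)
  ultimately show ?thesis
    using arc_interior_not_end_point[of ?j "1/2"] by simp
qed

lemma exists_not_top: "\<exists>y\<in>L. y \<noteq> v"
proof -
  obtain y A where "arc_from_to L v y A"
    using top by (auto simp: ramification_point_def)
  then have "y \<in> L" "y \<noteq> v"
    unfolding arc_from_to_def using arc_distinct_ends pathfinish_in_path_image by fastforce+
  then show ?thesis
    by blast
qed

lemma end_point_maximal:
  assumes "e \<in> end_points L" "y \<in> L" "e \<in> seg y"
  shows "y = e"
proof (rule ccontr)
  assume "y \<noteq> e"
  have "e \<noteq> v"
    using assms top_not_end_point by auto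
  then have "y \<noteq> v"
    using assms by auto
  then obtain g where g: "arc g" "path_image g = seg y" "g 0 = v" "g 1 = y"
    using seg_arc[OF assms(2)] by metis
  obtain t where t: "0 \<le> t" "t \<le> 1" "e = g t"
    using assms(3) unfolding g(2)[symmetric] path_image_def by auto
  then have "0 < t" "t < 1"
    using \<open>e \<noteq> v\<close> \<open>y \<noteq> e\<close> g by (auto simp: less_le)
  then show False
    using arc_interior_not_end_point[OF g(1)] g seg_subset assms t by auto
qed

text \<open>An arc through \<open>x\<close> leaves \<open>x\<close> in two directions, and only one of them can lead back
  along \<open>seg x\<close>; the other one prolongs \<open>seg x\<close>.\<close>

lemma maximal_imp_end_point:
  assumes x: "x \<in> L" and max: "\<And>y. y \<in> L \<Longrightarrow> x \<in> seg y \<Longrightarrow> y = x"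
  shows "x \<in> end_points L"
proof -
  have "x \<noteq> v"
    using exists_not_top max top_in_seg by metis
  then obtain k where k: "arc k" "path_image k = seg x" "k 0 = v" "k 1 = x"
    using seg_arc[OF x] by metis
  have kx: "k s \<in> seg x" if "0 \<le> s" "s \<le> 1" for s
    using in_path_image[OF that, of k] k(2) by simp
  have "pathstart k = v"
    using k(3) by (simp add: pathstart_def)
  have retrace: "\<exists>s<1. 0 \<le> s \<and> k s \<in> path_image b"
    if b: "arc b" "path_image b \<subseteq> L" "pathstart b = x" for b
  proof (rule ccontr)
    assume no: "\<not> ?thesis"
    have "path_image k \<inter> path_image b \<subseteq> {pathstart b}"
    proof
      fix p assume p: "p \<in> path_image k \<inter> path_image b"
      then obtain s where "0 \<le> s" "s \<le> 1" "p = k s"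
        by (auto simp: path_image_def)
      then show "p \<in> {pathstart b}"
        using no p b k by (cases "s = 1") (auto simp: not_less)
    qed
    then have "arc (k +++ b)"
      using k b by (intro arc_join) (auto simp: pathfinish_def)
    moreover have "path_image (k +++ b) = seg x \<union> path_image b"
      using k b by (subst path_image_join) (auto simp: pathfinish_def)
    ultimately have "seg (pathfinish b) = seg x \<union> path_image b"
      using seg_eqI[of "k +++ b"] b(2) seg_subset[OF x] \<open>pathstart k = v\<close> by simp
    then have "x \<in> seg (pathfinish b)"
      using self_in_seg x by blast
    then have "pathfinish b = x"
      using max b(2) pathfinish_in_path_image by blast
    then show False
      using arc_distinct_ends b by metis
  qed
  have "end_point_of_arc x A" if A: "A \<subseteq> L" "is_arc A" "x \<in> A" for A
  proof -
    obtain g where g: "arc g" "path_image g = A"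
      using A by (auto simp: is_arc_def)
    obtain t where t: "0 \<le> t" "t \<le> 1" "x = g t"
      using A(3) g(2) by (auto simp: path_image_def)
    have False if t': "t \<noteq> 0" "t \<noteq> 1"
    proof -
      obtain b1 where b1: "arc b1" "path_image b1 = g ` {0..t}" "pathfinish b1 = g t"
        by (rule arc_subarc[OF g(1), of 0 t]) (use t t' in auto)
      obtain b2 where b2: "arc b2" "path_image b2 = g ` {t..1}" "pathstart b2 = g t"
        by (rule arc_subarc[OF g(1), of t 1]) (use t t' in auto)
      have sub: "g ` {0..t} \<subseteq> L" "g ` {t..1} \<subseteq> L"
        using g(2) A(1) t by (auto simp: path_image_def)
      obtain s1 where s1: "s1 < 1" "0 \<le> s1" "k s1 \<in> g ` {0..t}"
        using retrace[of "reversepath b1"] b1 sub t by (auto simp: arc_reversepath)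
      obtain s2 where s2: "s2 < 1" "0 \<le> s2" "k s2 \<in> g ` {t..1}"
        using retrace[of b2] b2 sub t by auto
      \<comment> \<open>By connectedness each intersection contains \<open>k\<close> from its
        witness up to 1. Hence \<open>k u\<close> lies on both halves of \<open>g\<close>, which
        share only \<open>x = k 1\<close>, although \<open>u < 1\<close>.\<close>
      define u where "u = max s1 s2"
      have "k u \<in> seg x \<inter> g ` {0..t}"
      proof (rule connected_subset_arc_convex[OF k(1), of _ s1 1])
        show "connected (seg x \<inter> g ` {0..t})"
          using connected_Int_continua[of "seg x" "path_image b1"] continuum_arc[OF b1(1)]
            continuum_seg[OF x] seg_subset[OF x] sub b1 by auto
        show "k s1 \<in> seg x \<inter> g ` {0..t}" "k 1 \<in> seg x \<inter> g ` {0..t}"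
          using s1 kx[of s1] kx[of 1] t k(4) by simp_all
      qed (use k(2) s1 s2 in \<open>simp_all add: u_def\<close>)
      moreover have "k u \<in> seg x \<inter> g ` {t..1}"
      proof (rule connected_subset_arc_convex[OF k(1), of _ s2 1])
        show "connected (seg x \<inter> g ` {t..1})"
          using connected_Int_continua[of "seg x" "path_image b2"] continuum_arc[OF b2(1)]
            continuum_seg[OF x] seg_subset[OF x] sub b2 by auto
        show "k s2 \<in> seg x \<inter> g ` {t..1}" "k 1 \<in> seg x \<inter> g ` {t..1}"
          using s2 kx[of s2] kx[of 1] t k(4) by simp_all
      qed (use k(2) s1 s2 in \<open>simp_all add: u_def\<close>)
      ultimately obtain a b where ab: "0 \<le> a" "a \<le> t" "t \<le> b" "b \<le> 1" "k u = g a" "k u = g b"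
        by auto
      then have "a = b"
        using arc_eq_iff[OF g(1), of a b] t by simp
      then have "a = t"
        using ab by simp
      then have "k u = k 1"
        using ab(5) t(3) k(4) by simp
      then have "u = 1"
        using arc_eq_iff[OF k(1), of u 1] s1 s2 by (simp add: u_def)
      then show False
        using s1 s2 by (auto simp: u_def)
    qed
    then show ?thesis
      using g t by (auto simp: end_point_of_arc_def pathstart_def pathfinish_def)
  qed
  then show ?thesis
    using x by (simp add: end_points_def)
qed

end

subsection \<open>Smooth fans\<close>

text \<open>A real-valued \<open>SUP\<close> bounds its members only over a set that is bounded
  above; boundedness of \<open>A\<close> supplies this.\<close>

lemma infdist_le_hausdist:
  assumes "bounded A" "bounded B" "B \<noteq> {}"
  shows "a \<in> A \<Longrightarrow> infdist a B \<le> hausdist A B"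
proof -
  assume a: "a \<in> A"
  obtain b where b: "b \<in> B"
    using assms(3) by blast
  obtain M where M: "\<And>x. x \<in> A \<Longrightarrow> dist b x \<le> M"
    using assms(1) bounded_any_center by metis
  have "bdd_above ((\<lambda>a. infdist a B) ` A)"
    by (rule bdd_aboveI2[of _ _ M]) (metis M b dist_commute infdist_le2)
  then have "infdist a B \<le> (SUP a\<in>A. infdist a B)"
    using a by (rule cSUP_upper2) simp
  then show ?thesis
    by (simp add: hausdist_def)
qed

lemma hausdist_commute: "hausdist A B = hausdist B A"
  by (simp add: hausdist_def max.commute)

lemma infdist_le_infdist_plus_hausdist:
  assumes "bounded A" "bounded B" "A \<noteq> {}" "B \<noteq> {}"
  shows "infdist p B \<le> infdist p A + hausdist A B"
proof -
  have "infdist p B - hausdist A B \<le> dist p a" if "a \<in> A" for a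
    using infdist_triangle[of p B a] infdist_le_hausdist[OF assms(1,2,4) that] by simp
  then have "infdist p B - hausdist A B \<le> infdist p A"
    using assms(3) by (auto simp: infdist_notempty intro!: cINF_greatest)
  then show ?thesis
    by simp
qed

text \<open>The distance from a fixed point is 1-Lipschitz in the set, which turns Hausdorff
  convergence of arcs into convergence of real functions.\<close>

lemma abs_infdist_diff_le_hausdist:
  assumes "bounded A" "bounded B" "A \<noteq> {}" "B \<noteq> {}"
  shows "\<bar>infdist p A - infdist p B\<bar> \<le> hausdist A B"
  using infdist_le_infdist_plus_hausdist[of A B p] infdist_le_infdist_plus_hausdist[of B A p] assms
  by (simp add: hausdist_commute[of B A])

lemma compact_imp_dense_sequence:
  fixes S :: "'a::metric_space set"
  assumes "compact S" "S \<noteq> {}"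
  obtains d :: "nat \<Rightarrow> 'a" where "range d \<subseteq> S" "\<And>x e. x \<in> S \<Longrightarrow> 0 < e \<Longrightarrow> \<exists>n. dist (d n) x < e"
proof -
  have "\<exists>k. finite k \<and> k \<subseteq> S \<and> S \<subseteq> (\<Union>x\<in>k. ball x (1 / Suc n))" for n :: nat
    using seq_compact_imp_totally_bounded assms(1) unfolding compact_eq_seq_compact_metric by force
  then obtain k where k: "\<And>n. finite (k n)" "\<And>n. k n \<subseteq> S"
    "\<And>n::nat. S \<subseteq> (\<Union>x\<in>k n. ball x (1 / Suc n))"
    by metis
  define D where "D = (\<Union>n. k n)"
  have "countable D"
    unfolding D_def using k(1) by (intro countable_UN) (auto intro: countable_finite)
  moreover have "D \<noteq> {}"
    using k(3)[of 0] assms(2) by (auto simp: D_def)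
  ultimately have range: "range (from_nat_into D) = D"
    by (rule range_from_nat_into[rotated])
  show ?thesis
  proof (rule that)
    show "range (from_nat_into D) \<subseteq> S"
      using range k(2) by (auto simp: D_def)
    fix x and e :: real
    assume "x \<in> S" "0 < e"
    then obtain n :: nat where n: "1 / Suc n < e"
      using nat_approx_posE by blast
    obtain y where "y \<in> k n" "dist y x < 1 / Suc n"
      using k(3)[of n] \<open>x \<in> S\<close> by auto
    then have "y \<in> D" "dist y x < e"
      using n by (auto simp: D_def)
    then show "\<exists>n. dist (from_nat_into D n) x < e"
      using range by (metis imageE)
  qed
qed

locale pointed_smooth_fan = pointed_fan +
  assumes smooth: "smooth_fan L v"
begin

lemma hausdist_seg_tendsto:
  assumes "\<And>n. f n \<in> L" "y \<in> L" "f \<longlonglongrightarrow> y"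
  shows "(\<lambda>n. hausdist (seg (f n)) (seg y)) \<longlonglongrightarrow> 0"
  using smooth[unfolded smooth_fan_def, rule_format, of y f "seg y" "\<lambda>n. seg (f n)"] assms
  by (simp add: vx_segment_iff)

lemma seg_nonempty: "x \<in> L \<Longrightarrow> seg x \<noteq> {}"
  using self_in_seg by blast

lemma bounded_seg: "x \<in> L \<Longrightarrow> bounded (seg x)"
  by (simp add: compact_imp_bounded compact_seg)

text \<open>Upper semicontinuity of the arcs: the order is a closed relation. The upper sets, the
  sets whose complement is formed by the end points, and the set of pairs behind a Cantor fan are
  closed for this reason.\<close>

lemma seg_closed_graph:
  assumes f: "\<And>n. f n \<in> L" "y \<in> L" "f \<longlonglongrightarrow> y" and g: "\<And>n. g n \<in> seg (f n)" "g \<longlonglongrightarrow> x"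
  shows "x \<in> seg y"
proof -
  have "infdist (g n) (seg y) \<le> hausdist (seg (f n)) (seg y)" for n
    using f g by (intro infdist_le_hausdist) (auto simp: bounded_seg seg_nonempty)
  moreover have "(\<lambda>n. infdist (g n) (seg y)) \<longlonglongrightarrow> infdist x (seg y)"
    using g(2) by (intro tendsto_intros)
  ultimately have "infdist x (seg y) \<le> 0"
    using hausdist_seg_tendsto[OF f] LIMSEQ_le by blast
  then have "infdist x (seg y) = 0"
    using infdist_nonneg[of x "seg y"] by simp
  then show ?thesis
    using in_closed_iff_infdist_zero[OF compact_imp_closed[OF compact_seg[OF f(2)]] seg_nonempty[OF f(2)]]
    by simp
qed

lemma infdist_seg_continuous: "continuous_on L (\<lambda>x. infdist p (seg x))"
proof (rule continuous_on_sequentiallyI)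
  fix f y assume f: "\<forall>n. f n \<in> L" "y \<in> L" "f \<longlonglongrightarrow> y"
  have "\<bar>infdist p (seg (f n)) - infdist p (seg y)\<bar> \<le> hausdist (seg (f n)) (seg y)" for n
    using f by (intro abs_infdist_diff_le_hausdist) (auto simp: bounded_seg seg_nonempty)
  then have "(\<lambda>n. infdist p (seg (f n)) - infdist p (seg y)) \<longlonglongrightarrow> 0"
    by (intro Lim_null_comparison[OF always_eventually hausdist_seg_tendsto[of f y]]) (use f in auto)
  then show "(\<lambda>n. infdist p (seg (f n))) \<longlonglongrightarrow> infdist p (seg y)"
    by (rule LIM_zero_cancel)
qed

text \<open>A Whitney map restricted to the arcs issuing from the top.\<close>

lemma monotone_height:
  obtains \<phi> :: "'a \<Rightarrow> real" where "continuous_on L \<phi>" "\<phi> v = 0"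
    "\<And>x y. y \<in> L \<Longrightarrow> x \<in> seg y \<Longrightarrow> x \<noteq> y \<Longrightarrow> \<phi> x < \<phi> y"
proof -
  obtain d :: "nat \<Rightarrow> 'a" where d: "range d \<subseteq> L" "\<And>x e. x \<in> L \<Longrightarrow> 0 < e \<Longrightarrow> \<exists>n. dist (d n) x < e"
    using compact_imp_dense_sequence[OF compact_L] top_in by blast
  obtain M where M: "\<And>x. x \<in> L \<Longrightarrow> dist x v \<le> M"
    using compact_imp_bounded[OF compact_L] bounded_any_center[of L v] by (metis dist_commute)
  \<comment> \<open>Since \<open>v \<in> seg x\<close>, the difference lies between 0 and
    \<open>dist (d n) v\<close>; it vanishes for \<open>x = v\<close> and grows with the arc. The
    powers make the series converge uniformly.\<close>
  define a where "a n x = (1/2)^n * (dist (d n) v - infdist (d n) (seg x))" for n x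
  define \<phi> where "\<phi> x = (\<Sum>n. a n x)" for x
  have bound: "norm (a n x) \<le> (1/2)^n * M" if "x \<in> L" for n x
  proof -
    have "infdist (d n) (seg x) \<le> dist (d n) v"
      using top_in_seg[OF that] by (rule infdist_le)
    moreover have "dist (d n) v \<le> M"
      using M d(1) by blast
    ultimately show ?thesis
      using infdist_nonneg[of "d n" "seg x"] by (simp add: a_def abs_mult)
  qed
  have sumM: "summable (\<lambda>n. (1/2::real)^n * M)"
    by (intro summable_mult2 summable_geometric) simp
  have suma: "summable (\<lambda>n. a n x)" if "x \<in> L" for x
    using bound[OF that] by (intro summable_comparison_test'[OF sumM]) auto
  have "uniform_limit L (\<lambda>n x. \<Sum>i<n. a i x) \<phi> sequentially"
    unfolding \<phi>_def using bound sumM by (intro Weierstrass_m_test) auto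
  moreover have "continuous_on L (a n)" for n
    unfolding a_def by (intro continuous_intros infdist_seg_continuous)
  ultimately have cont: "continuous_on L \<phi>"
    by (intro uniform_limit_theorem[of _ "\<lambda>n x. \<Sum>i<n. a i x"])
      (auto intro!: always_eventually continuous_on_sum)
  have strict: "\<phi> x < \<phi> y" if y: "y \<in> L" and x: "x \<in> seg y" "x \<noteq> y" for x y
  proof -
    have xL: "x \<in> L"
      using x y seg_subset by blast
    have "y \<notin> seg x"
      using seg_antisym x y by blast
    then have pos: "infdist y (seg x) > 0"
      using xL by (intro infdist_pos_not_in_closed) (auto simp: compact_imp_closed compact_seg seg_nonempty)
    \<comment> \<open>Such a \<open>d n\<close> is nearer to \<open>seg y\<close> than to
      \<open>seg x\<close>, so one term of the series increases strictly while none
      decreases.\<close>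
    obtain n where n: "dist (d n) y < infdist y (seg x) / 2"
      using d(2)[OF y, of "infdist y (seg x) / 2"] pos by auto
    have "infdist (d n) (seg y) \<le> dist (d n) y"
      using self_in_seg[OF y] by (rule infdist_le)
    also have "\<dots> < infdist (d n) (seg x)"
      using n infdist_triangle[of y "seg x" "d n"] by (simp add: dist_commute)
    finally have less: "a n x < a n y"
      by (simp add: a_def)
    have "a m x \<le> a m y" for m
      using infdist_mono[OF seg_mono[OF y x(1)] seg_nonempty[OF xL]] by (simp add: a_def)
    then have "0 < (\<Sum>m. a m y - a m x)"
      using less by (intro suminf_pos2[of _ n] summable_diff suma xL y) auto
    then show ?thesis
      using suminf_diff[OF suma[OF y] suma[OF xL]] by (simp add: \<phi>_def)
  qed
  have "\<phi> v = 0"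
    by (simp add: \<phi>_def a_def)
  then show ?thesis
    using that cont strict by blast
qed

text \<open>The points above \<open>x\<close> form a compact set. One of greatest height is maximal
  in the order, as anything above it would be higher still.\<close>

lemma end_point_above:
  assumes "x \<in> L"
  obtains e where "e \<in> end_points L" "x \<in> seg e"
proof -
  obtain \<phi> :: "'a \<Rightarrow> real" where cont: "continuous_on L \<phi>"
    and strict: "\<And>x y. y \<in> L \<Longrightarrow> x \<in> seg y \<Longrightarrow> x \<noteq> y \<Longrightarrow> \<phi> x < \<phi> y"
    using monotone_height by metis
  define U where "U = {y \<in> L. x \<in> seg y}"
  have "closed U"
    unfolding closed_sequential_limits
  proof (intro allI impI, elim conjE)
    fix f y assume f: "\<forall>n. f n \<in> U" "f \<longlonglongrightarrow> y"
    then have "y \<in> L"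
      using closed_sequentially[OF compact_imp_closed[OF compact_L], of f] by (simp add: U_def)
    then show "y \<in> U"
      using f seg_closed_graph[of f y "\<lambda>_. x" x] by (auto simp: U_def)
  qed
  then have "compact U"
    using compact_L compact_Int_closed[of L U] by (simp add: U_def Int_def)
  moreover have "x \<in> U"
    using assms self_in_seg by (simp add: U_def)
  moreover have "continuous_on U \<phi>"
    using cont by (rule continuous_on_subset) (auto simp: U_def)
  ultimately obtain e where e: "e \<in> U" "\<And>y. y \<in> U \<Longrightarrow> \<phi> y \<le> \<phi> e"
    using continuous_attains_sup[of U \<phi>] by blast
  have "e \<in> end_points L"
  proof (rule maximal_imp_end_point)
    fix y assume y: "y \<in> L" "e \<in> seg y"
    then have "y \<in> U"
      using e(1) seg_mono by (auto simp: U_def)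
    then show "y = e"
      using strict[OF y] e(2)[of y] by force
  qed (use e in \<open>auto simp: U_def\<close>)
  then show ?thesis
    using that e by (auto simp: U_def)
qed

lemma end_points_Gdelta:
  obtains F :: "nat \<Rightarrow> 'a set" where "\<And>n. closed (F n)" "end_points L = L - (\<Union>n. F n)"
proof -
  \<comment> \<open>The points with something above them at distance at least 1/(n+1). Such a bound
    survives limits, whereas merely being different does not.\<close>
  define F where "F n = {x. \<exists>y\<in>L. x \<in> seg y \<and> 1 / Suc n \<le> dist x y}" for n :: nat
  have "closed (F n)" for n
    unfolding closed_sequential_limits
  proof (intro allI impI, elim conjE)
    fix f x assume f: "\<forall>m. f m \<in> F n" "f \<longlonglongrightarrow> x"
    then obtain g where g: "\<And>m. g m \<in> L" "\<And>m. f m \<in> seg (g m)" "\<And>m. 1 / Suc n \<le> dist (f m) (g m)"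
      unfolding F_def by (simp, metis)
    obtain y r where y: "y \<in> L" "strict_mono r" "(g \<circ> r) \<longlonglongrightarrow> y"
      using compact_L g(1) unfolding compact_def by metis
    have fr: "(f \<circ> r) \<longlonglongrightarrow> x"
      using f(2) y(2) by (rule LIMSEQ_subseq_LIMSEQ)
    have "x \<in> seg y"
      using seg_closed_graph[of "g \<circ> r" y "f \<circ> r" x] g y fr by simp
    moreover have "1 / Suc n \<le> dist x y"
      using tendsto_dist[OF fr y(3)] g(3) by (intro LIMSEQ_le_const) (auto simp: o_def)
    ultimately show "x \<in> F n"
      using y by (auto simp: F_def)
  qed
  moreover have "end_points L = L - (\<Union>n. F n)"
  proof (intro equalityI subsetI)
    fix e assume e: "e \<in> end_points L"
    then have "e \<notin> F n" for n
      unfolding F_def using end_point_maximal[OF e] by fastforce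
    then show "e \<in> L - (\<Union>n. F n)"
      using e by (auto simp: end_points_def)
  next
    fix x assume x: "x \<in> L - (\<Union>n. F n)"
    show "x \<in> end_points L"
    proof (rule maximal_imp_end_point)
      fix y assume y: "y \<in> L" "x \<in> seg y"
      show "y = x"
      proof (rule ccontr)
        assume "y \<noteq> x"
        then obtain n :: nat where "1 / Suc n < dist x y"
          using nat_approx_posE[of "dist x y"] by auto
        then have "x \<in> F n"
          using y by (auto simp: F_def intro!: bexI[of _ y])
        with x show False
          by blast
      qed
    qed (use x in blast)
  qed
  ultimately show ?thesis
    using that by blast
qed

end

subsection \<open>Copies of the Cantor space\<close>

text \<open>The sequences agreeing with \<open>w\<close> in the first \<open>N\<close> coordinates
  form a neighbourhood base at \<open>w\<close> in the product topology.\<close>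

lemma continuous_on_binary_iff:
  fixes h :: "(nat \<Rightarrow> bool) \<Rightarrow> 'a::metric_space"
  shows "continuous_on UNIV h \<longleftrightarrow>
    (\<forall>w. \<forall>e>0. \<exists>N. \<forall>w'. (\<forall>n<N. w' n = w n) \<longrightarrow> dist (h w') (h w) < e)"
proof (intro iffI allI impI)
  fix w and e :: real
  assume cont: "continuous_on UNIV h" and "0 < e"
  have "open (h -` ball (h w) e)"
    using cont open_ball by (rule open_vimage[rotated])
  then have "openin (product_topology (\<lambda>i. euclidean) UNIV) (h -` ball (h w) e)"
    by (simp add: open_fun_def)
  moreover have "w \<in> h -` ball (h w) e"
    using \<open>0 < e\<close> by simp
  ultimately obtain X where X: "w \<in> Pi\<^sub>E UNIV X" "finite {i. X i \<noteq> topspace (euclidean :: bool topology)}"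
    "Pi\<^sub>E UNIV X \<subseteq> h -` ball (h w) e"
    using product_topology_open_contains_basis[of "\<lambda>i. euclidean" UNIV "h -` ball (h w) e" w] by blast
  obtain N where N: "\<And>i. X i \<noteq> UNIV \<Longrightarrow> i < N"
    using X(2) unfolding finite_nat_set_iff_bounded by auto
  have "dist (h w') (h w) < e" if w': "\<forall>n<N. w' n = w n" for w'
  proof -
    have "w' i \<in> X i" for i
      using N[of i] w' X(1) by (cases "X i = UNIV") (auto simp: PiE_iff)
    then have "w' \<in> Pi\<^sub>E UNIV X"
      by (simp add: PiE_iff)
    then have "w' \<in> h -` ball (h w) e"
      using X(3) by blast
    then show ?thesis
      by (simp add: dist_commute)
  qed
  then show "\<exists>N. \<forall>w'. (\<forall>n<N. w' n = w n) \<longrightarrow> dist (h w') (h w) < e"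
    by blast
next
  assume h: "\<forall>w. \<forall>e>0. \<exists>N. \<forall>w'. (\<forall>n<N. w' n = w n) \<longrightarrow> dist (h w') (h w) < e"
  show "continuous_on UNIV h"
    unfolding continuous_on_def tendsto_iff
  proof (intro ballI allI impI)
    fix w and e :: real
    assume "0 < e"
    then obtain N where N: "\<And>w'. (\<forall>n<N. w' n = w n) \<Longrightarrow> dist (h w') (h w) < e"
      using h by metis
    have "open (\<Inter>n\<in>{..<N}. (\<lambda>w'. w' n) -` {w n})"
      by (intro open_INT ballI open_vimage[OF open_discrete continuous_on_product_coordinates]) simp
    moreover have "w \<in> (\<Inter>n\<in>{..<N}. (\<lambda>w'. w' n) -` {w n})"
      by simp
    ultimately show "\<forall>\<^sub>F w' in at w. dist (h w') (h w) < e"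
      unfolding eventually_at_topological
      by (intro exI[of _ "\<Inter>n\<in>{..<N}. (\<lambda>w'. w' n) -` {w n}"] conjI ballI impI N) auto
  qed
qed

lemma compact_UNIV_binary: "compact (UNIV :: (nat \<Rightarrow> bool) set)"
proof -
  have "compact_space (product_topology (\<lambda>i. euclidean :: bool topology) (UNIV :: nat set))"
    unfolding compact_space_product_topology
    by (auto simp: compact_space_def compactin_euclidean_iff intro: finite_imp_compact)
  then show ?thesis
    unfolding euclidean_product_topology by (simp add: compact_space_def compactin_euclidean_iff)
qed

text \<open>An embedding of the Cantor space: continuity of the inverse is automatic, the domain
  being compact and the target Hausdorff.\<close>

definition cantor_param :: "((nat \<Rightarrow> bool) \<Rightarrow> 'a::metric_space) \<Rightarrow> bool" where
  "cantor_param h \<longleftrightarrow> continuous_on UNIV h \<and> inj h"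

definition cantor_copy :: "'a::metric_space set \<Rightarrow> bool" where
  "cantor_copy K \<longleftrightarrow> (\<exists>h. cantor_param h \<and> range h = K)"

lemma cantor_copy_range: "cantor_param h \<Longrightarrow> cantor_copy (range h)"
  by (auto simp: cantor_copy_def)

lemma cantor_copy_compact: "cantor_copy K \<Longrightarrow> compact K"
  unfolding cantor_copy_def cantor_param_def
  using compact_continuous_image compact_UNIV_binary by blast

lemma cantor_copy_nonempty: "cantor_copy K \<Longrightarrow> K \<noteq> {}"
  by (auto simp: cantor_copy_def)

section \<open>Slices of a Cantor set\<close>

text \<open>The standard identification of the square of the Cantor space with the Cantor space;
  fixing the first factor cuts out a slice.\<close>

definition interleave :: "(nat \<Rightarrow> bool) \<Rightarrow> (nat \<Rightarrow> bool) \<Rightarrow> nat \<Rightarrow> bool" where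
  "interleave z u n = (if even n then z (n div 2) else u (n div 2))"

lemma interleave_eq_iff: "interleave z u = interleave z' u' \<longleftrightarrow> z = z' \<and> u = u'"
proof
  assume eq: "interleave z u = interleave z' u'"
  have "z n = z' n" "u n = u' n" for n
    using fun_cong[OF eq, of "2 * n"] fun_cong[OF eq, of "2 * n + 1"] by (simp_all add: interleave_def)
  then show "z = z' \<and> u = u'"
    by auto
qed simp

lemma interleave_surj: "\<exists>z u. w = interleave z u"
proof (intro exI ext)
  fix n
  show "w n = interleave (\<lambda>i. w (2 * i)) (\<lambda>i. w (2 * i + 1)) n"
    by (auto simp: interleave_def)
qed

lemma continuous_on_interleave: "continuous_on UNIV (interleave z)"
proof (rule continuous_on_coordinatewise_then_product)
  fix i
  show "continuous_on UNIV (\<lambda>u. interleave z u i)"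
    by (cases "even i") (simp_all add: interleave_def)
qed

definition slice :: "((nat \<Rightarrow> bool) \<Rightarrow> 'a) \<Rightarrow> (nat \<Rightarrow> bool) \<Rightarrow> 'a set" where
  "slice h z = range (h \<circ> interleave z)"

lemma cantor_param_slice: "cantor_param h \<Longrightarrow> cantor_param (h \<circ> interleave z)"
proof -
  assume h: "cantor_param h"
  have "inj (interleave z)"
    by (simp add: inj_def interleave_eq_iff)
  then show ?thesis
    using h unfolding cantor_param_def
    by (metis continuous_on_compose continuous_on_interleave continuous_on_subset inj_compose subset_UNIV)
qed

lemma cantor_copy_slice: "cantor_param h \<Longrightarrow> cantor_copy (slice h z)"
  unfolding slice_def by (intro cantor_copy_range cantor_param_slice)

lemma slice_subset: "slice h z \<subseteq> range h"
  by (auto simp: slice_def)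

lemma slice_disjoint: "cantor_param h \<Longrightarrow> z \<noteq> z' \<Longrightarrow> slice h z \<inter> slice h z' = {}"
  by (auto simp: slice_def cantor_param_def inj_eq interleave_eq_iff)

lemma in_some_slice: "x \<in> range h \<Longrightarrow> \<exists>z. x \<in> slice h z"
  unfolding slice_def using interleave_surj by (metis comp_apply imageE rangeI)

text \<open>A member of the partition is indexed by its own points: it is cut into as many slices as it
  has points.\<close>

lemma cantor_partition_indexed_by_points:
  fixes E :: "'a::metric_space set"
  assumes P: "\<And>K. K \<in> P \<Longrightarrow> cantor_copy K" "pairwise disjnt P" "\<Union>P = E"
  obtains S where "\<And>e. e \<in> E \<Longrightarrow> cantor_copy (S e)"
    "\<And>e e'. e \<in> E \<Longrightarrow> e' \<in> E \<Longrightarrow> e \<noteq> e' \<Longrightarrow> S e \<inter> S e' = {}" "(\<Union>e\<in>E. S e) = E"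
proof -
  have "\<exists>K. K \<in> P \<and> e \<in> K" if "e \<in> E" for e
    using that P(3) by blast
  then obtain k where k: "\<And>e. e \<in> E \<Longrightarrow> k e \<in> P" "\<And>e. e \<in> E \<Longrightarrow> e \<in> k e"
    by metis
  obtain h where h: "\<And>K. K \<in> P \<Longrightarrow> cantor_param (h K)" "\<And>K. K \<in> P \<Longrightarrow> range (h K) = K"
    using P(1) unfolding cantor_copy_def by metis
  \<comment> \<open>The parameter of the point \<open>e\<close> within its member is reused as the
    label of a slice of that member.\<close>
  define S where "S e = slice (h (k e)) (inv (h (k e)) e)" for e
  have same: "k e = K" if "K \<in> P" "e \<in> K" for e K
    using k[of e] that P(2,3) unfolding pairwise_def disjnt_iff by blast
  have sub: "S e \<subseteq> k e" if "e \<in> E" for e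
    using h(2)[OF k(1)[OF that]] slice_subset unfolding S_def by metis
  show ?thesis
  proof (rule that)
    show "cantor_copy (S e)" if "e \<in> E" for e
      unfolding S_def using that h k by (intro cantor_copy_slice) auto
    show "S e \<inter> S e' = {}" if e: "e \<in> E" "e' \<in> E" "e \<noteq> e'" for e e'
    proof (cases "k e = k e'")
      case True
      have "inv (h (k e)) e \<noteq> inv (h (k e)) e'"
        using e k[of e] k[of e'] h(2)[of "k e"] True by (metis f_inv_into_f)
      then show ?thesis
        unfolding S_def True[symmetric] using slice_disjoint h(1) k(1) e(1) by blast
    next
      case False
      then have "k e \<inter> k e' = {}"
        using P(2) k e unfolding pairwise_def disjnt_def by blast
      then show ?thesis
        using sub e by blast
    qed
    show "(\<Union>e\<in>E. S e) = E"
    proof (intro equalityI subsetI)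
      fix f assume "f \<in> (\<Union>e\<in>E. S e)"
      then show "f \<in> E"
        using sub k(1) P(3) by blast
    next
      fix f assume f: "f \<in> E"
      then obtain z where z: "f \<in> slice (h (k f)) z"
        using in_some_slice h(2) k by metis
      \<comment> \<open>The slice through \<open>f\<close> has label \<open>z\<close>, hence it was
        assigned to the point of the same member whose parameter is \<open>z\<close>.\<close>
      define e where "e = h (k f) z"
      have "e \<in> k f"
        unfolding e_def using h(2)[OF k(1)[OF f]] by blast
      then have "k e = k f" "e \<in> E"
        using same k(1)[OF f] P(3) by auto
      moreover have "inv (h (k f)) e = z"
        unfolding e_def using h(1)[OF k(1)[OF f]] by (simp add: cantor_param_def)
      ultimately have "f \<in> S e"
        using z by (simp add: S_def)
      then show "f \<in> (\<Union>e\<in>E. S e)"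
        using \<open>e \<in> E\<close> by blast
    qed
  qed
qed

text \<open>The Cantor space is the one-point compactification of countably many copies of itself:
  decode a sequence by the position of its first \<open>True\<close>.\<close>

lemma cantor_copy_cluster:
  fixes h :: "nat \<Rightarrow> (nat \<Rightarrow> bool) \<Rightarrow> 'a::metric_space"
  assumes h: "\<And>n. cantor_param (h n)"
    and disj: "\<And>m n. m \<noteq> n \<Longrightarrow> range (h m) \<inter> range (h n) = {}"
    and x: "\<And>n. x \<notin> range (h n)"
    and r: "\<And>n. range (h n) \<subseteq> cball x (r n)" "r \<longlonglongrightarrow> 0"
  shows "cantor_copy (insert x (\<Union>n. range (h n)))"
proof -
  define l where "l w = (LEAST n. w n)" for w :: "nat \<Rightarrow> bool"
  \<comment> \<open>The coordinates after the first \<open>True\<close> give the position in the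
    copy; the sequence without any \<open>True\<close> is the point at infinity
    \<open>x\<close>.\<close>
  define H where "H w = (if \<exists>n. w n then h (l w) (\<lambda>i. w (Suc (l w) + i)) else x)" for w
  have l: "w (l w)" "\<And>n. n < l w \<Longrightarrow> \<not> w n" if "\<exists>n. w n" for w
    using that not_less_Least unfolding l_def by (auto intro: LeastI)
  have l_eqI: "l w = n" if "w n" "\<And>m. m < n \<Longrightarrow> \<not> w m" for w n
    unfolding l_def using that by (intro Least_equality) (auto simp: not_less[symmetric])
  have Hl: "H w \<in> range (h (l w))" if "\<exists>n. w n" for w
    using that by (simp add: H_def)
  have "continuous_on UNIV H"
    unfolding continuous_on_binary_iff
  proof (intro allI impI)
    fix w and e :: real
    assume "0 < e"
    show "\<exists>N. \<forall>w'. (\<forall>n<N. w' n = w n) \<longrightarrow> dist (H w') (H w) < e"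
    proof (cases "\<exists>n. w n")
      case True
      let ?s = "\<lambda>w i. w (Suc (l w) + i)"
      obtain N where N: "\<And>u. (\<forall>n<N. u n = ?s w n) \<Longrightarrow> dist (h (l w) u) (h (l w) (?s w)) < e"
        using h[of "l w"] \<open>0 < e\<close> unfolding cantor_param_def continuous_on_binary_iff by metis
      \<comment> \<open>\<open>Suc (l w)\<close> coordinates fix the copy, the next \<open>N\<close>
        control the position in it.\<close>
      have "dist (H w') (H w) < e" if w': "\<forall>n<Suc (l w) + N. w' n = w n" for w'
      proof -
        have "l w' = l w"
          using l[OF True] w' by (intro l_eqI) auto
        moreover have "\<exists>n. w' n"
          using l(1)[OF True] w' by (metis add_Suc less_Suc_eq_le le_add1)
        ultimately show ?thesis
          using True N[of "?s w'"] w' by (simp add: H_def)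
      qed
      then show ?thesis
        by blast
    next
      case False
      \<comment> \<open>A sequence that is \<open>False\<close> up to \<open>N\<close> has its first
        \<open>True\<close> at \<open>N\<close> or later, where the copies lie within
        \<open>e\<close> of \<open>x\<close>.\<close>
      obtain N where N: "\<And>n. n \<ge> N \<Longrightarrow> r n < e"
        using order_tendstoD(2)[OF r(2) \<open>0 < e\<close>] by (auto simp: eventually_sequentially)
      have "dist (H w') (H w) < e" if w': "\<forall>n<N. w' n = w n" for w'
      proof (cases "\<exists>n. w' n")
        case True
        then have "N \<le> l w'"
          using l(1)[OF True] w' False by (metis not_less)
        moreover have "dist x (H w') \<le> r (l w')"
          using Hl[OF True] r(1) by (meson mem_cball subsetD)
        ultimately show ?thesis
          using N[of "l w'"] False by (simp add: H_def[of w] dist_commute)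
      next
        case False
        then show ?thesis
          using \<open>\<not> (\<exists>n. w n)\<close> \<open>0 < e\<close> by (simp add: H_def)
      qed
      then show ?thesis
        by blast
    qed
  qed
  moreover have "inj H"
  proof (rule injI)
    fix w w' assume eq: "H w = H w'"
    show "w = w'"
    proof (cases "\<exists>n. w n")
      case True
      have True': "\<exists>n. w' n"
        using Hl[OF True] x eq unfolding H_def[of w'] by (metis (full_types))
      have ll: "l w = l w'"
        using disj Hl[OF True] Hl[OF True'] eq by (metis IntI empty_iff)
      have "(\<lambda>i. w (Suc (l w) + i)) = (\<lambda>i. w' (Suc (l w) + i))"
        using eq True True' ll h[of "l w"] by (simp add: H_def cantor_param_def inj_eq)
      then have tail: "w (Suc (l w) + i) = w' (Suc (l w) + i)" for i
        by metis
      show ?thesis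
      proof
        fix n
        consider "n < l w" | "n = l w" | i where "n = Suc (l w) + i"
          by (metis less_iff_Suc_add linorder_neqE_nat add_Suc)
        then show "w n = w' n"
          using l[OF True] l[OF True'] ll tail by cases auto
      qed
    next
      case False
      then have "\<not> (\<exists>n. w' n)"
        using Hl[of w'] x eq by (auto simp: H_def[of w])
      then show ?thesis
        using False by auto
    qed
  qed
  moreover have "range H = insert x (\<Union>n. range (h n))"
  proof (intro equalityI subsetI)
    fix y assume "y \<in> range H"
    then show "y \<in> insert x (\<Union>n. range (h n))"
      by (auto simp: H_def)
  next
    fix y assume "y \<in> insert x (\<Union>n. range (h n))"
    then consider "y = x" | n u where "y = h n u"
      by auto
    then show "y \<in> range H"
    proof cases
      case 1
      then have "y = H (\<lambda>_. False)"
        by (simp add: H_def)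
      then show ?thesis
        by simp
    next
      case 2
      define w where "w i = (if i < n then False else if i = n then True else u (i - Suc n))" for i
      have "l w = n"
        by (rule l_eqI) (auto simp: w_def)
      moreover have "\<exists>n. w n"
        by (rule exI[of _ n]) (simp add: w_def)
      ultimately have "H w = h n u"
        by (simp add: H_def w_def)
      then show ?thesis
        using 2 by (metis rangeI)
    qed
  qed
  ultimately show ?thesis
    unfolding cantor_copy_def cantor_param_def by blast
qed

section \<open>Cantor schemes and partitions into Cantor sets\<close>

text \<open>A Cantor scheme: a binary tree of shrinking closed balls centred in \<open>E\<close>,
  the two children of a node being disjoint. The balls made at stage \<open>n\<close> avoid
  \<open>F n\<close>, so the limit of a branch, found in the compact \<open>L\<close>, lies in
  \<open>E\<close>.\<close>

lemma cantor_copy_in_perfect_Gdelta: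
  fixes L :: "'a::metric_space set"
  assumes L: "compact L" and F: "\<And>n::nat. closed (F n)" and E: "E = L - (\<Union>n. F n)"
    and perf: "\<And>e r. e \<in> E \<Longrightarrow> 0 < r \<Longrightarrow> \<exists>e'\<in>E. e' \<noteq> e \<and> dist e' e < r"
    and e: "e \<in> E" "0 < \<rho>"
  obtains K where "cantor_copy K" "K \<subseteq> E" "K \<subseteq> ball e \<rho>"
proof -
  define good where "good s \<longleftrightarrow> fst s \<in> E \<and> 0 < snd s" for s :: "'a \<times> real"
  define B where "B s = cball (fst s) (snd s)" for s :: "'a \<times> real"
  have shrink: "\<exists>q. 0 < q \<and> q \<le> \<delta> \<and> cball y q \<subseteq> ball x r \<and> cball y q \<inter> F n = {}"
    if "y \<in> E" "y \<in> ball x r" "0 < \<delta>" for y x r n \<delta>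
  proof -
    have "open (ball x r - F n)" "y \<in> ball x r - F n"
      using that E F by auto
    then obtain q where "0 < q" "cball y q \<subseteq> ball x r - F n"
      using open_contains_cball by metis
    then show ?thesis
      using that(3) by (intro exI[of _ "min q \<delta>"]) (auto simp: subset_iff)
  qed
  define child where "child n s t \<longleftrightarrow> B (t False) \<inter> B (t True) = {} \<and>
      (\<forall>b. good (t b) \<and> snd (t b) \<le> (1/2)^n \<and> B (t b) \<subseteq> ball (fst s) (snd s) \<and> B (t b) \<inter> F n = {})"
    for n s and t :: "bool \<Rightarrow> 'a \<times> real"
  have "\<exists>t. child n s t" if "good s" for n s
  proof -
    obtain x r where s: "s = (x, r)"
      by (cases s)
    then have x: "x \<in> E" "0 < r"
      using that by (auto simp: good_def)
    obtain y where y: "y \<in> E" "y \<noteq> x" "dist y x < r"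
      using perf x by blast
    \<comment> \<open>A third of the distance keeps the two balls disjoint; the power makes the
      radii tend to 0, as continuity of the limit map requires.\<close>
    define \<delta> where "\<delta> = min ((1/2)^n) (dist x y / 3)"
    have "0 < \<delta>"
      using y by (simp add: \<delta>_def)
    obtain q0 where q0: "0 < q0" "q0 \<le> \<delta>" "cball x q0 \<subseteq> ball x r" "cball x q0 \<inter> F n = {}"
      using shrink[of x x r \<delta> n] x \<open>0 < \<delta>\<close> by auto
    obtain q1 where q1: "0 < q1" "q1 \<le> \<delta>" "cball y q1 \<subseteq> ball x r" "cball y q1 \<inter> F n = {}"
      using shrink[of y x r \<delta> n] y \<open>0 < \<delta>\<close> by (auto simp: dist_commute)
    have "q0 + q1 < dist x y"
    proof -
      have "q0 \<le> dist x y / 3" "q1 \<le> dist x y / 3" "0 < dist x y"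
        using q0(2) q1(2) y by (auto simp: \<delta>_def)
      then show ?thesis
        by linarith
    qed
    then have disj: "cball x q0 \<inter> cball y q1 = {}"
    proof -
      have "\<not> (dist x p \<le> q0 \<and> dist y p \<le> q1)" for p
        using \<open>q0 + q1 < dist x y\<close> dist_triangle2[of x y p] by linarith
      then show ?thesis
        by auto
    qed
    define t where "t b = (if b then (y, q1) else (x, q0))" for b
    have "q0 \<le> (1/2)^n" "q1 \<le> (1/2)^n"
      using q0(2) q1(2) by (auto simp: \<delta>_def)
    then show ?thesis
      using q0 q1 x y disj by (intro exI[of _ t]) (simp add: child_def t_def good_def B_def s)
  qed
  moreover define t where "t n s = (SOME t. child n s t)" for n s
  ultimately have "child n s (t n s)" if "good s" for n s
    using that by (simp add: someI_ex)
  then have t: "\<And>n s b. good s \<Longrightarrow> good (t n s b)"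
    "\<And>n s. good s \<Longrightarrow> B (t n s False) \<inter> B (t n s True) = {}"
    "\<And>n s b. good s \<Longrightarrow> snd (t n s b) \<le> (1/2)^n"
    "\<And>n s b. good s \<Longrightarrow> B (t n s b) \<subseteq> ball (fst s) (snd s)"
    "\<And>n s b. good s \<Longrightarrow> B (t n s b) \<inter> F n = {}"
    by (simp_all add: child_def)
  define st where "st w = rec_nat (e, \<rho>) (\<lambda>n s. t n s (w n))" for w :: "nat \<Rightarrow> bool"
  have st: "st w 0 = (e, \<rho>)" "st w (Suc n) = t n (st w n) (w n)" for w n
    by (simp_all add: st_def)
  have good: "good (st w n)" for w n
    by (induction n) (use e t(1) in \<open>auto simp: st good_def\<close>)
  have step: "B (st w (Suc n)) \<subseteq> ball (fst (st w n)) (snd (st w n))" for w n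
    unfolding st by (rule t(4)[OF good])
  have agree: "st w n = st w' n" if "\<forall>i<n. w i = w' i" for w w' n
    using that by (induction n) (auto simp: st)
  \<comment> \<open>The balls are nested with centres in \<open>L\<close>, which yields the finite
    intersection property. The intersection with \<open>L\<close> supplies compactness, which closed
    balls of a metric space may lack.\<close>
  have "L \<inter> (\<Inter>n. B (st w n)) \<noteq> {}" for w
  proof (rule compact_imp_fip_image[OF L])
    show "closed (B (st w n))" for n
      by (simp add: B_def)
    fix I :: "nat set" assume "finite I"
    then obtain N where N: "\<And>n. n \<in> I \<Longrightarrow> n \<le> N"
      using finite_nat_set_iff_bounded_le by auto
    have "B (st w (Suc n)) \<subseteq> B (st w n)" for n
      using step[of w n] ball_subset_cball unfolding B_def by blast
    then have "B (st w N) \<subseteq> B (st w n)" if "n \<in> I" for n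
      using N[OF that] by (rule lift_Suc_antimono_le)
    moreover have "fst (st w N) \<in> L \<inter> B (st w N)"
      using good[of w N] E by (simp add: good_def B_def)
    ultimately show "L \<inter> (\<Inter>n\<in>I. B (st w n)) \<noteq> {}"
      by blast
  qed
  then have "\<exists>x. x \<in> L \<and> (\<forall>n. x \<in> B (st w n))" for w
    by blast
  then obtain h where h: "\<And>w. h w \<in> L" "\<And>w n. h w \<in> B (st w n)"
    by metis
  have "h w \<in> E" for w
  proof -
    have "h w \<notin> F n" for n
      using h(2)[of w "Suc n"] t(5)[OF good[of w n], of n "w n"] by (auto simp: st)
    then show ?thesis
      using h(1) E by blast
  qed
  moreover have "h w \<in> ball e \<rho>" for w
    using h(2)[of w "Suc 0"] step[of w 0] unfolding st(1) by auto
  moreover have "continuous_on UNIV h"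
    unfolding continuous_on_binary_iff
  proof (intro allI impI)
    fix w and \<epsilon> :: real
    assume "0 < \<epsilon>"
    then obtain n where n: "(1/2)^n < \<epsilon> / 2"
      using real_arch_pow_inv[of "\<epsilon>/2" "1/2"] by auto
    have "dist (h w') (h w) < \<epsilon>" if w': "\<forall>i<Suc n. w' i = w i" for w'
    proof -
      define s where "s = st w (Suc n)"
      have "dist (fst s) (h w) \<le> snd s"
        using h(2)[of w "Suc n"] by (simp add: s_def B_def)
      moreover have "dist (fst s) (h w') \<le> snd s"
        using h(2)[of w' "Suc n"] agree[OF w'] by (simp add: s_def B_def)
      moreover have "snd s \<le> (1/2)^n"
        unfolding s_def st(2) by (rule t(3)[OF good])
      ultimately show ?thesis
        using dist_triangle3[of "h w'" "h w" "fst s"] n by linarith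
    qed
    then show "\<exists>N. \<forall>w'. (\<forall>n<N. w' n = w n) \<longrightarrow> dist (h w') (h w) < \<epsilon>"
      by blast
  qed
  moreover have "inj h"
  proof (rule injI, rule ccontr)
    fix w w' assume eq: "h w = h w'" and "w \<noteq> w'"
    then have ex: "\<exists>n. w n \<noteq> w' n"
      by auto
    define n where "n = (LEAST n. w n \<noteq> w' n)"
    have n: "w n \<noteq> w' n" "\<forall>i<n. w i = w' i"
      using LeastI_ex[OF ex] not_less_Least unfolding n_def by auto
    have "st w n = st w' n"
      using agree n(2) by blast
    then have "h w \<in> B (t n (st w n) (w n)) \<inter> B (t n (st w n) (w' n))"
      using h(2)[of w "Suc n"] h(2)[of w' "Suc n"] eq by (simp add: st)
    then show False
      using t(2)[OF good[of w n], of n] n(1) by (cases "w n"; cases "w' n") auto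
  qed
  ultimately have "cantor_copy (range h)" "range h \<subseteq> E" "range h \<subseteq> ball e \<rho>"
    by (auto simp: cantor_copy_def cantor_param_def)
  then show ?thesis
    using that by blast
qed

text \<open>A greedy choice: the Cantor sets chosen so far have a compact union inside
  \<open>E\<close>, and by \<open>nlc\<close> such a set contains no neighbourhood in
  \<open>E\<close> of a point of \<open>E\<close>, so there is room left in
  \<open>U n\<close>.\<close>

lemma disjoint_cantor_copies:
  fixes L :: "'a::metric_space set"
  assumes L: "compact L" and F: "\<And>n::nat. closed (F n)" and E: "E = L - (\<Union>n. F n)"
    and nlc: "\<And>e r Q. \<lbrakk>e \<in> E; 0 < r; compact Q; Q \<subseteq> E\<rbrakk> \<Longrightarrow> \<exists>e'\<in>E. e' \<notin> Q \<and> dist e' e < r"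
    and U: "\<And>n::nat. open (U n)" "\<And>n. U n \<inter> E \<noteq> {}"
  obtains Q :: "nat \<Rightarrow> 'a set" where "\<And>n. cantor_copy (Q n)" "\<And>n. Q n \<subseteq> U n \<inter> E"
    "\<And>m n. m \<noteq> n \<Longrightarrow> Q m \<inter> Q n = {}"
proof -
  have perf: "\<exists>e'\<in>E. e' \<noteq> e \<and> dist e' e < r" if "e \<in> E" "0 < r" for e r
    using nlc[OF that, of "{e}"] that by auto
  define ok where "ok n R K \<longleftrightarrow> cantor_copy K \<and> K \<subseteq> U n \<inter> E \<and> K \<inter> R = {}" for n R K
  have ex: "\<exists>K. ok n R K" if R: "compact R" "R \<subseteq> E" for n R
  proof -
    obtain e where e: "e \<in> U n" "e \<in> E"
      using U(2)[of n] by blast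
    obtain r where r: "0 < r" "ball e r \<subseteq> U n"
      using U(1)[of n] e(1) open_contains_ball by blast
    obtain e' where e': "e' \<in> E" "e' \<notin> R" "dist e' e < r"
      using nlc[OF e(2) r(1) R] by blast
    have "open (ball e r - R)" "e' \<in> ball e r - R"
      using e' R by (auto simp: compact_imp_closed open_Diff dist_commute)
    then obtain q where q: "0 < q" "ball e' q \<subseteq> ball e r - R"
      using open_contains_ball by blast
    obtain K where K: "cantor_copy K" "K \<subseteq> E" "K \<subseteq> ball e' q"
      by (rule cantor_copy_in_perfect_Gdelta[OF L F E perf e'(1) q(1)])
    then have "ok n R K"
      unfolding ok_def using q r by auto
    then show ?thesis ..
  qed
  define k where "k n R = (SOME K. ok n R K)" for n R
  have k: "ok n R (k n R)" if "compact R" "R \<subseteq> E" for n R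
    unfolding k_def using ex[OF that] by (rule someI_ex)
  \<comment> \<open>The recursion carries only the union of the sets chosen so far; the sets
    themselves are recovered as \<open>k n (R n)\<close>.\<close>
  define R where "R = rec_nat {} (\<lambda>n R. R \<union> k n R)"
  have R_Suc: "R 0 = {}" "R (Suc n) = R n \<union> k n (R n)" for n
    by (simp_all add: R_def)
  have R: "compact (R n) \<and> R n \<subseteq> E" for n
  proof (induction n)
    case (Suc n)
    then have "ok n (R n) (k n (R n))"
      using k by simp
    then show ?case
      using Suc unfolding R_Suc ok_def by (simp add: cantor_copy_compact compact_Un)
  qed (simp add: R_Suc)
  have ok: "ok n (R n) (k n (R n))" for n
    using k R[of n] by simp
  have less: "k m (R m) \<inter> k n (R n) = {}" if "m < n" for m n
  proof -
    have "R (Suc m) \<subseteq> R n"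
      by (rule lift_Suc_mono_le[of R]) (use that in \<open>simp_all add: R_Suc\<close>)
    then show ?thesis
      using ok[of n] unfolding ok_def R_Suc by blast
  qed
  show ?thesis
  proof (rule that[of "\<lambda>n. k n (R n)"])
    show "cantor_copy (k n (R n))" "k n (R n) \<subseteq> U n \<inter> E" for n
      using ok[of n] by (simp_all add: ok_def)
    show "k m (R m) \<inter> k n (R n) = {}" if "m \<noteq> n" for m n
      using less[of m n] less[of n m] that by (cases "m < n") (auto simp: Int_commute)
  qed
qed

lemma cantor_partition:
  fixes L :: "'a::metric_space set"
  assumes L: "compact L" and F: "\<And>n::nat. closed (F n)" and E: "E = L - (\<Union>n. F n)"
    and nlc: "\<And>e r Q. \<lbrakk>e \<in> E; 0 < r; compact Q; Q \<subseteq> E\<rbrakk> \<Longrightarrow> \<exists>e'\<in>E. e' \<notin> Q \<and> dist e' e < r"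
  obtains P where "\<And>K. K \<in> P \<Longrightarrow> cantor_copy K" "pairwise disjnt P" "\<Union>P = E"
proof (cases "E = {}")
  case True
  then show ?thesis
    by (intro that[of "{}"]) auto
next
  case False
  \<comment> \<open>The dense sequence is taken in the closure, because that is compact; balls about
    its points still meet \<open>E\<close>.\<close>
  have "compact (closure E)"
  proof -
    have "closure E \<subseteq> L"
      using L E by (intro closure_minimal) (auto simp: compact_imp_closed)
    then show ?thesis
      using compact_Int_closed[OF L closed_closure, of E] by (simp add: Int_absorb1)
  qed
  then obtain d :: "nat \<Rightarrow> 'a" where d: "range d \<subseteq> closure E"
    "\<And>x e. x \<in> closure E \<Longrightarrow> 0 < e \<Longrightarrow> \<exists>n. dist (d n) x < e"
    using False by (elim compact_imp_dense_sequence) auto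
  define U where "U m = (case prod_decode m of (i, j) \<Rightarrow> ball (d i) (1 / Suc j))" for m
  have U_encode: "U (prod_encode (i, j)) = ball (d i) (1 / Suc j)" for i j
    by (simp add: U_def)
  have U_open: "open (U m)" for m
    by (simp add: U_def split: prod.split)
  have U_meets: "U m \<inter> E \<noteq> {}" for m
  proof -
    obtain i j where m: "prod_decode m = (i, j)"
      by (cases "prod_decode m")
    have "d i \<in> closure E"
      using d(1) by blast
    then obtain y where "y \<in> E" "dist y (d i) < 1 / Suc j"
      unfolding closure_approachable by (metis divide_pos_pos of_nat_0_less_iff zero_less_Suc zero_less_one)
    then show ?thesis
      using m by (auto simp: U_def dist_commute)
  qed
  obtain Q where Q: "\<And>n. cantor_copy (Q n)" "\<And>n. Q n \<subseteq> U n \<inter> E"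
    "\<And>m n. m \<noteq> n \<Longrightarrow> Q m \<inter> Q n = {}"
    using disjoint_cantor_copies[where U = U, OF L F E nlc U_open U_meets] by blast
  obtain h where h: "\<And>n. cantor_param (h n)" "\<And>n. range (h n) = Q n"
    using Q(1) unfolding cantor_copy_def by metis
  \<comment> \<open>The label of \<open>x\<close>: the members of the base that contain
    \<open>x\<close>. Small balls separate points, so different points of \<open>E\<close> have
    different labels.\<close>
  define z where "z x m \<longleftrightarrow> x \<in> U m" for x m
  have near: "\<exists>i. dist (d i) x < 1 / Suc n" if "x \<in> E" for x and n :: nat
    using d(2)[of x "1 / Suc n"] that closure_subset[of E] by auto
  have z_inj: "z x \<noteq> z y" if x: "x \<in> E" and "x \<noteq> y" for x y
  proof -
    have "0 < dist x y / 2"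
      using that by simp
    then obtain j :: nat where j: "1 / Suc j < dist x y / 2"
      by (rule nat_approx_posE)
    obtain i where i: "dist (d i) x < 1 / Suc j"
      using near[OF x] by blast
    have "dist x y \<le> dist (d i) x + dist (d i) y"
      by (rule dist_triangle3)
    then have "\<not> dist (d i) y < 1 / Suc j"
      using i j by linarith
    then have "z x (prod_encode (i, j)) \<noteq> z y (prod_encode (i, j))"
      using i by (simp add: z_def U_encode)
    then show ?thesis
      by auto
  qed
  define E' where "E' = E - (\<Union>m. Q m)"
  have "\<exists>i. dist (d i) x < 1 / Suc n" if "x \<in> E'" for x and n :: nat
    using near that by (simp add: E'_def)
  then obtain ix where ix: "\<And>x n. x \<in> E' \<Longrightarrow> dist (d (ix x n)) x < 1 / Suc n"
    by metis
  \<comment> \<open>The ball numbered \<open>m x n\<close> has radius 1/(n+1) and contains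
    \<open>x\<close>, whence the radius 2/(n+1) below. Keeping \<open>n\<close> in the code makes
    \<open>m x\<close> injective, so no slice is repeated in a cluster.\<close>
  define m where "m x n = prod_encode (ix x n, n)" for x n
  have m_inj: "m x n \<noteq> m x n'" if "n \<noteq> n'" for x n n'
    using that by (simp add: m_def)
  have Q_near: "Q (m x n) \<subseteq> cball x (2 / Suc n)" if "x \<in> E'" for x n
  proof
    fix y assume "y \<in> Q (m x n)"
    then have "dist (d (ix x n)) y < 1 / Suc n"
      using Q(2)[of "m x n"] by (auto simp: m_def U_encode)
    then have "dist x y \<le> 2 * (1 / Suc n)"
      using ix[OF that, of n] dist_triangle3[of x y "d (ix x n)"] by linarith
    then show "y \<in> cball x (2 / Suc n)"
      by simp
  qed
  define K where "K x = insert x (\<Union>n. slice (h (m x n)) (z x))" for x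
  \<comment> \<open>A slice is used up only if some \<open>x\<close> has both its label and its
    index; all other slices are members by themselves.\<close>
  define P where "P = K ` E' \<union> {slice (h n) u | n u. \<not> (\<exists>x\<in>E'. u = z x \<and> n \<in> range (m x))}"
  have sub: "slice (h n) u \<subseteq> Q n" for n u
    using slice_subset h(2) by metis
  have slices: "slice (h n) u \<inter> slice (h n') u' = {}" if "(n, u) \<noteq> (n', u')" for n u n' u'
  proof (cases "n = n'")
    case True
    then show ?thesis
      using slice_disjoint[OF h(1)] that by auto
  next
    case False
    then show ?thesis
      using Q(3) sub by blast
  qed
  have xQ: "x \<notin> slice (h n) u" if "x \<in> E'" for x n u
    using sub that by (auto simp: E'_def)
  have K_cantor: "cantor_copy (K x)" if x: "x \<in> E'" for x
    unfolding K_def slice_def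
  proof (rule cantor_copy_cluster[where r = "\<lambda>n. 2 / Suc n"])
    show "cantor_param (h (m x n) \<circ> interleave (z x))" for n
      by (rule cantor_param_slice[OF h(1)])
    show "range (h (m x k) \<circ> interleave (z x)) \<inter> range (h (m x n) \<circ> interleave (z x)) = {}"
      if "k \<noteq> n" for k n
      using slices[of "m x k" "z x" "m x n" "z x"] m_inj[OF that] by (simp add: slice_def)
    show "x \<notin> range (h (m x n) \<circ> interleave (z x))" for n
      using xQ[OF x] by (simp add: slice_def)
    show "range (h (m x n) \<circ> interleave (z x)) \<subseteq> cball x (2 / Suc n)" for n
      using sub[of "m x n" "z x"] Q_near[OF x, of n] by (simp add: slice_def)
    show "(\<lambda>n. 2 / Suc n) \<longlonglongrightarrow> 0"
      using tendsto_mult_right_zero[OF LIMSEQ_inverse_real_of_nat, of 2] by (simp add: field_simps)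
  qed
  have K_disj: "K x \<inter> K y = {}" if x: "x \<in> E'" and y: "y \<in> E'" and "x \<noteq> y" for x y
  proof -
    have "z x \<noteq> z y"
      using z_inj x \<open>x \<noteq> y\<close> by (simp add: E'_def)
    then have "slice (h n) (z x) \<inter> slice (h n') (z y) = {}" for n n'
      by (intro slices) simp
    then show ?thesis
      using xQ[OF x] xQ[OF y] \<open>x \<noteq> y\<close> unfolding K_def by blast
  qed
  have K_slice: "K x \<inter> slice (h n) u = {}" if x: "x \<in> E'" and nu: "\<not> (u = z x \<and> n \<in> range (m x))" for x n u
  proof -
    have "slice (h (m x i)) (z x) \<inter> slice (h n) u = {}" for i
      using nu by (intro slices) auto
    then show ?thesis
      using xQ[OF x] unfolding K_def by blast
  qed
  show ?thesis
  proof (rule that)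
    show "cantor_copy A" if "A \<in> P" for A
      using that K_cantor cantor_copy_slice[OF h(1)] by (auto simp: P_def)
    show "pairwise disjnt P"
    proof (rule pairwiseI)
      fix A B assume AB: "A \<in> P" "B \<in> P" "A \<noteq> B"
      from AB(1) consider (K) x where "x \<in> E'" "A = K x"
        | (slice) n u where "A = slice (h n) u" "\<not> (\<exists>x\<in>E'. u = z x \<and> n \<in> range (m x))"
        by (auto simp: P_def)
      then have "A \<inter> B = {}"
      proof cases
        case (K x)
        from AB(2) consider y where "y \<in> E'" "B = K y"
          | n u where "B = slice (h n) u" "\<not> (\<exists>x\<in>E'. u = z x \<and> n \<in> range (m x))"
          by (auto simp: P_def)
        then show ?thesis
        proof cases
          case (1 y)
          then show ?thesis
            using K_disj[of x y] K AB(3) by blast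
        next
          case (2 n u)
          then show ?thesis
            using K_slice[of x u n] K by blast
        qed
      next
        case (slice n u)
        from AB(2) consider y where "y \<in> E'" "B = K y"
          | n' u' where "B = slice (h n') u'"
          by (auto simp: P_def)
        then show ?thesis
        proof cases
          case (1 y)
          then show ?thesis
            using K_slice[of y u n] slice by blast
        next
          case (2 n' u')
          then show ?thesis
            using slices[of n u n' u'] slice AB(3) by blast
        qed
      qed
      then show "disjnt A B"
        by (simp add: disjnt_def)
    qed
    show "\<Union>P = E"
    proof (intro equalityI subsetI)
      fix y assume "y \<in> \<Union>P"
      then have "y \<in> E' \<or> (\<exists>n u. y \<in> slice (h n) u)"
        by (auto simp: P_def K_def)
      then show "y \<in> E"
        unfolding E'_def using sub Q(2) by blast
    next
      fix y assume y: "y \<in> E"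
      show "y \<in> \<Union>P"
      proof (cases "y \<in> E'")
        case True
        then have "y \<in> K y" "K y \<in> P"
          by (auto simp: K_def P_def)
        then show ?thesis
          by blast
      next
        case False
        then obtain n where "y \<in> Q n"
          using y by (auto simp: E'_def)
        then obtain u where u: "y \<in> slice (h n) u"
          using in_some_slice h(2) by metis
        show ?thesis
        proof (cases "\<exists>x\<in>E'. u = z x \<and> n \<in> range (m x)")
          case True
          then obtain x where "x \<in> E'" "y \<in> K x"
            using u by (auto simp: K_def)
          then show ?thesis
            by (auto simp: P_def)
        next
          case False
          then have "slice (h n) u \<in> P"
            by (auto simp: P_def)
          then show ?thesis
            using u by blast
        qed
      qed
    qed
  qed
qed

subsection \<open>Cantor fans\<close>

definition ternary :: "(nat \<Rightarrow> bool) \<Rightarrow> real" where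
  "ternary w = (\<Sum>n. (if w n then 2 else 0) / 3 ^ (n + 1))"

lemma sums_two_thirds: "(\<lambda>n. 2 / 3 ^ (n + N + 1)) sums (1 / 3 ^ N :: real)"
proof -
  have "(\<lambda>n. 2 / 3 ^ (N + 1) * (1/3) ^ n) sums (2 / 3 ^ (N + 1) * (1 / (1 - 1/3)) :: real)"
    by (intro sums_mult geometric_sums) simp
  moreover have "2 / 3 ^ (N + 1) * (1/3) ^ n = (2 / 3 ^ (n + N + 1) :: real)" for n
    by (simp add: power_add power_divide)
  ultimately show ?thesis
    by simp
qed

lemma summable_ternary: "summable (\<lambda>n. (if w n then 2 else 0) / 3 ^ (n + 1) :: real)"
  by (rule summable_comparison_test'[OF sums_summable[OF sums_two_thirds[of 0]], of 0]) simp

text \<open>The tail is largest when all its digits are 2, and then it is a geometric series with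
  sum \<open>1 / 3 ^ N\<close>. Continuity and injectivity both rest on this bound.\<close>

lemma ternary_split:
  obtains \<tau> where "ternary w = (\<Sum>n<N. (if w n then 2 else 0) / 3 ^ (n + 1)) + \<tau>" "0 \<le> \<tau>" "\<tau> \<le> 1 / 3 ^ N"
proof -
  let ?c = "\<lambda>n. (if w n then 2 else 0) / 3 ^ (n + 1) :: real"
  have sum: "summable (\<lambda>n. ?c (n + N))"
    using summable_ternary by (rule summable_ignore_initial_segment)
  have "(\<Sum>n. ?c (n + N)) \<le> (\<Sum>n. 2 / 3 ^ (n + N + 1))"
    by (intro suminf_le sum sums_summable[OF sums_two_thirds]) simp
  also have "\<dots> = 1 / 3 ^ N"
    using sums_two_thirds by (rule sums_unique[symmetric])
  finally have "(\<Sum>n. ?c (n + N)) \<le> 1 / 3 ^ N" .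
  moreover have "0 \<le> (\<Sum>n. ?c (n + N))"
    by (intro suminf_nonneg sum) simp
  moreover have "ternary w = (\<Sum>n<N. ?c n) + (\<Sum>n. ?c (n + N))"
    unfolding ternary_def using suminf_split_initial_segment[OF summable_ternary, of w N] by (simp add: add.commute)
  ultimately show ?thesis
    using that by blast
qed

text \<open>At the first difference \<open>w'\<close> gains \<open>2 / 3 ^ Suc N\<close>, of which
  the tail of \<open>w\<close> can recover at most half.\<close>

lemma ternary_less:
  assumes "\<forall>n<N. w n = w' n" "\<not> w N" "w' N"
  shows "ternary w < ternary w'"
proof -
  obtain \<tau> where \<tau>: "ternary w = (\<Sum>n<Suc N. (if w n then 2 else 0) / 3 ^ (n + 1)) + \<tau>"
    "0 \<le> \<tau>" "\<tau> \<le> 1 / 3 ^ Suc N"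
    by (rule ternary_split)
  obtain \<tau>' where \<tau>': "ternary w' = (\<Sum>n<Suc N. (if w' n then 2 else 0) / 3 ^ (n + 1)) + \<tau>'"
    "0 \<le> \<tau>'" "\<tau>' \<le> 1 / 3 ^ Suc N"
    by (rule ternary_split)
  have "(\<Sum>n<N. (if w n then 2 else 0) / 3 ^ (n + 1)) = (\<Sum>n<N. (if w' n then 2 else 0) / 3 ^ (n + 1) :: real)"
    using assms(1) by (intro sum.cong) auto
  then have "ternary w' - ternary w = 2 / 3 ^ Suc N + \<tau>' - \<tau>"
    using \<tau>(1) \<tau>'(1) assms(2,3) by simp
  moreover have "(0::real) < 1 / 3 ^ Suc N" "(2 / 3 ^ Suc N :: real) = 2 * (1 / 3 ^ Suc N)"
    by simp_all
  ultimately show ?thesis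
    using \<tau>(3) \<tau>'(2) by linarith
qed

lemma cantor_param_ternary: "cantor_param ternary"
  unfolding cantor_param_def
proof
  show "continuous_on UNIV ternary"
    unfolding continuous_on_binary_iff
  proof (intro allI impI)
    fix w and e :: real
    assume "0 < e"
    then obtain N where N: "(1/3) ^ N < e"
      using real_arch_pow_inv[of e "1/3"] by auto
    have "dist (ternary w') (ternary w) < e" if w': "\<forall>n<N. w' n = w n" for w'
    proof -
      obtain \<tau> where \<tau>: "ternary w = (\<Sum>n<N. (if w n then 2 else 0) / 3 ^ (n + 1)) + \<tau>"
        "0 \<le> \<tau>" "\<tau> \<le> 1 / 3 ^ N"
        by (rule ternary_split)
      obtain \<tau>' where \<tau>': "ternary w' = (\<Sum>n<N. (if w' n then 2 else 0) / 3 ^ (n + 1)) + \<tau>'"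
        "0 \<le> \<tau>'" "\<tau>' \<le> 1 / 3 ^ N"
        by (rule ternary_split)
      have "(\<Sum>n<N. (if w' n then 2 else 0) / 3 ^ (n + 1)) = (\<Sum>n<N. (if w n then 2 else 0) / 3 ^ (n + 1) :: real)"
        using w' by (intro sum.cong) auto
      then have "dist (ternary w') (ternary w) \<le> 1 / 3 ^ N"
        using \<tau> \<tau>' by (simp add: dist_real_def abs_le_iff)
      then show ?thesis
        using N by (simp add: power_one_over)
    qed
    then show "\<exists>N. \<forall>w'. (\<forall>n<N. w' n = w n) \<longrightarrow> dist (ternary w') (ternary w) < e"
      by blast
  qed
  show "inj ternary"
  proof (rule injI, rule ccontr)
    fix w w' assume eq: "ternary w = ternary w'" and "w \<noteq> w'"
    then have ex: "\<exists>n. w n \<noteq> w' n"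
      by auto
    define N where "N = (LEAST n. w n \<noteq> w' n)"
    have N: "w N \<noteq> w' N" "\<forall>n<N. w n = w' n"
      using LeastI_ex[OF ex] not_less_Least unfolding N_def by auto
    then show False
      using ternary_less[of N w w'] ternary_less[of N w' w] eq by (cases "w N") auto
  qed
qed

lemma range_ternary: "range ternary = cantor_set"
proof (intro equalityI subsetI)
  fix x assume "x \<in> range ternary"
  then obtain w where w: "x = ternary w"
    by blast
  define d :: "nat \<Rightarrow> nat" where "d n = (if w n then 2 else 0)" for n
  have "x = (\<Sum>n. real (d n) / 3 ^ (n + 1))"
    unfolding w ternary_def d_def by (intro arg_cong[where f = suminf] ext) simp
  moreover have "\<forall>n. d n \<in> {0, 2}"
    by (simp add: d_def)
  ultimately show "x \<in> cantor_set"
    unfolding cantor_set_def by blast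
next
  fix x assume "x \<in> cantor_set"
  then obtain d :: "nat \<Rightarrow> nat" where d: "\<forall>n. d n \<in> {0, 2}" "x = (\<Sum>n. real (d n) / 3 ^ (n + 1))"
    by (auto simp: cantor_set_def)
  have "real (d n) = (if d n = 2 then 2 else 0)" for n
    using d(1) by (metis insertE of_nat_0 of_nat_numeral singletonD)
  then have "x = ternary (\<lambda>n. d n = 2)"
    unfolding d(2) ternary_def by simp
  then show "x \<in> range ternary"
    by blast
qed

section \<open>The legs over a Cantor set of end points\<close>

lemma standard_cantor_fan_eq:
  "standard_cantor_fan = {((1 - u) / 2 + u * c, u) | c u. c \<in> cantor_set \<and> 0 \<le> u \<and> u \<le> 1}"
  unfolding standard_cantor_fan_def closed_segment_def by (auto simp: field_simps)

text \<open>Continuous maps from a compact space to Hausdorff spaces are quotient maps onto their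
  images, so both images are the quotient of \<open>W\<close> by one equivalence relation.\<close>

lemma homeomorphic_same_fibres:
  fixes p :: "'a::topological_space \<Rightarrow> 'b::t2_space" and q :: "'a \<Rightarrow> 'c::t2_space"
  assumes W: "compact W" and p: "continuous_on W p" and q: "continuous_on W q"
    and fibres: "\<And>a b. a \<in> W \<Longrightarrow> b \<in> W \<Longrightarrow> p a = p b \<longleftrightarrow> q a = q b"
  shows "p ` W homeomorphic q ` W"
proof -
  define f where "f y = q (inv_into W p y)" for y
  have f: "f (p a) = q a" if "a \<in> W" for a
    using fibres[of "inv_into W p (p a)" a] that
    by (simp add: f_def f_inv_into_f inv_into_into)
  have cpt: "compact (p ` W)"
    using p W by (rule compact_continuous_image)
  have "continuous_on (p ` W) f"
    unfolding continuous_on_closed_vimage[OF compact_imp_closed[OF cpt]]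
  proof (intro allI impI)
    fix B :: "'c set" assume "closed B"
    then have "compact (W \<inter> q -` B)"
      using continuous_closedin_preimage[OF q] closedin_compact[OF W] by blast
    then have "compact (p ` (W \<inter> q -` B))"
      using p by (intro compact_continuous_image) (auto intro: continuous_on_subset)
    moreover have "f -` B \<inter> p ` W = p ` (W \<inter> q -` B)"
      using f by auto
    ultimately show "closed (f -` B \<inter> p ` W)"
      by (simp add: compact_imp_closed)
  qed
  moreover have "f ` p ` W = q ` W"
    using f by (auto simp: image_image)
  moreover have "inj_on f (p ` W)"
    using f fibres by (auto simp: inj_on_def)
  ultimately show ?thesis
    by (rule homeomorphic_compact[OF cpt])
qed

context pointed_smooth_fan
begin

text \<open>A common point other than \<open>v\<close> makes the two end points comparable, and
  comparable maximal points are equal. Hence disjoint sets of end points give fans that meet only in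
  \<open>v\<close>.\<close>

lemma seg_end_points_disjoint:
  assumes "e \<in> end_points L" "e' \<in> end_points L" "x \<in> seg e" "x \<in> seg e'" "x \<noteq> v"
  shows "e = e'"
proof -
  have "e \<in> L" "e' \<in> L"
    using assms by (auto simp: end_points_def)
  then have "e \<in> seg e' \<or> e' \<in> seg e"
    using seg_linear_above assms(3-5) by metis
  then show ?thesis
    using end_point_maximal[OF assms(1) \<open>e' \<in> L\<close>] end_point_maximal[OF assms(2) \<open>e \<in> L\<close>] by metis
qed

text \<open>The two fans are compared through the set \<open>W\<close> of pairs of an end point and
  a point of its leg, because the relative height on a leg depends on \<open>e\<close>, which the
  point \<open>v\<close> does not determine. Both maps out of \<open>W\<close> glue exactly the
  copies of the top.\<close>

lemma cantor_fan_Union_seg: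
  assumes K: "cantor_copy K" "K \<subseteq> end_points L"
  shows "cantor_fan (\<Union>e\<in>K. seg e)"
proof -
  obtain \<phi> :: "'a \<Rightarrow> real" where cont: "continuous_on L \<phi>" and \<phi>v: "\<phi> v = 0"
    and strict: "\<And>x y. y \<in> L \<Longrightarrow> x \<in> seg y \<Longrightarrow> x \<noteq> y \<Longrightarrow> \<phi> x < \<phi> y"
    using monotone_height by metis
  obtain h where "cantor_param h" "range h = K"
    using K(1) unfolding cantor_copy_def by blast
  then have h: "continuous_on UNIV h" "inj h" "range h = K"
    by (simp_all add: cantor_param_def)
  have KL: "K \<subseteq> L"
    using K(2) by (auto simp: end_points_def)
  \<comment> \<open>\<open>(\<kappa> e, 1)\<close> is the far end of the straight segment that
    corresponds to the leg ending in \<open>e\<close>.\<close>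
  define \<kappa> where "\<kappa> e = ternary (inv h e)" for e
  have \<kappa>h: "\<kappa> (h w) = ternary w" for w
    using h(2) by (simp add: \<kappa>_def)
  have "continuous_on K (inv h)"
    using continuous_on_inv[OF h(1) compact_UNIV_binary, of "inv h"] h(2,3) by simp
  then have cont\<kappa>: "continuous_on K \<kappa>"
    unfolding \<kappa>_def using cantor_param_ternary unfolding cantor_param_def
    by (metis continuous_on_compose2 subset_UNIV)
  have \<kappa>_inj: "e = e'" if ee: "e \<in> K" "e' \<in> K" "\<kappa> e = \<kappa> e'" for e e'
  proof -
    obtain w w' where "e = h w" "e' = h w'"
      using ee(1,2) h(3) by blast
    then show ?thesis
      using ee(3) cantor_param_ternary by (simp add: \<kappa>h cantor_param_def inj_eq)
  qed
  have \<kappa>_range: "\<kappa> ` K = cantor_set"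
    unfolding h(3)[symmetric] image_image \<kappa>h range_ternary ..
  have \<phi>_le: "\<phi> x \<le> \<phi> y" if "y \<in> L" "x \<in> seg y" for x y
    using strict[OF that] by (cases "x = y") auto
  have \<phi>_pos: "0 < \<phi> x" if "x \<in> L" "x \<noteq> v" for x
    using strict[OF that(1) top_in_seg[OF that(1)]] that \<phi>v by auto
  have e_pos: "0 < \<phi> e" if "e \<in> K" for e
    using that K(2) KL top_not_end_point by (intro \<phi>_pos) auto
  have \<phi>_inj: "x = y" if "e \<in> L" "x \<in> seg e" "y \<in> seg e" "\<phi> x = \<phi> y" for x y e
  proof -
    have xy: "x \<in> L" "y \<in> L"
      using that(1-3) seg_subset by blast+
    have "x \<in> seg y \<or> y \<in> seg x"
      using seg_linear that(1-3) by metis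
    then show ?thesis
      using strict[OF xy(1), of y] strict[OF xy(2), of x] that(4) by (metis less_irrefl)
  qed
  define W where "W = {(e, y). e \<in> K \<and> y \<in> seg e}"
  have WL: "W \<subseteq> K \<times> L"
    unfolding W_def using seg_subset KL by blast
  have "compact W"
  proof -
    have KxL: "compact (K \<times> L)"
      using cantor_copy_compact[OF K(1)] compact_L by (rule compact_Times)
    have "closed W"
      unfolding closed_sequential_limits
    proof (intro allI impI, elim conjE)
      fix f p assume f: "\<forall>n. f n \<in> W" "f \<longlonglongrightarrow> p"
      have "p \<in> K \<times> L"
        using f WL closed_sequentially[OF compact_imp_closed[OF KxL], of f p] by blast
      moreover have "snd p \<in> seg (fst p)"
      proof (rule seg_closed_graph)
        show "(\<lambda>n. fst (f n)) \<longlonglongrightarrow> fst p" "(\<lambda>n. snd (f n)) \<longlonglongrightarrow> snd p"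
          using f(2) by (auto intro: tendsto_fst tendsto_snd)
        have fW: "fst (f n) \<in> K \<and> snd (f n) \<in> seg (fst (f n))" for n
          using f(1)[rule_format, of n] by (auto simp: W_def)
        then show "snd (f n) \<in> seg (fst (f n))" "fst (f n) \<in> L" for n
          using KL by auto
        show "fst p \<in> L"
          using \<open>p \<in> K \<times> L\<close> KL by auto
      qed
      ultimately show "p \<in> W"
        by (auto simp: W_def)
    qed
    then show ?thesis
      using compact_Int_closed[OF KxL, of W] WL by (simp add: Int_absorb1)
  qed
  moreover have "continuous_on W snd"
    by (intro continuous_intros)
  moreover
  \<comment> \<open>The point at relative height \<open>\<phi> y / \<phi> e\<close> on the segment
    from \<open>(1/2, 0)\<close> to \<open>(\<kappa> e, 1)\<close>.\<close>
  define q where "q p = ((1 - \<phi> (snd p) / \<phi> (fst p)) / 2 + \<phi> (snd p) / \<phi> (fst p) * \<kappa> (fst p), \<phi> (snd p) / \<phi> (fst p))"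
    for p
  have "continuous_on W q"
  proof -
    have "continuous_on W (\<lambda>p. \<phi> (fst p))" "continuous_on W (\<lambda>p. \<phi> (snd p))"
      using WL KL by (auto intro!: continuous_on_compose2[OF cont] continuous_intros)
    moreover have "continuous_on W (\<lambda>p. \<kappa> (fst p))"
      using WL by (auto intro!: continuous_on_compose2[OF cont\<kappa>] continuous_intros)
    moreover have "\<forall>p\<in>W. \<phi> (fst p) \<noteq> 0"
      using e_pos WL by fastforce
    ultimately show ?thesis
      unfolding q_def by (intro continuous_intros) simp_all
  qed
  moreover have "snd a = snd b \<longleftrightarrow> q a = q b" if ab: "a \<in> W" "b \<in> W" for a b
  proof -
    obtain e x e' y where a: "a = (e, x)" "e \<in> K" "x \<in> seg e" and b: "b = (e', y)" "e' \<in> K" "y \<in> seg e'"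
      using ab by (auto simp: W_def)
    have L: "e \<in> L" "e' \<in> L" "x \<in> L" "y \<in> L"
      using a b KL seg_subset by blast+
    show ?thesis
    proof
      assume "snd a = snd b"
      then have "x = y"
        using a b by simp
      show "q a = q b"
      proof (cases "x = v")
        case True
        then show ?thesis
          using a b \<open>x = y\<close> \<phi>v by (simp add: q_def)
      next
        case False
        then have "e = e'"
          using seg_end_points_disjoint[of e e' x] a b \<open>x = y\<close> K(2) by auto
        then show ?thesis
          using a b \<open>x = y\<close> by simp
      qed
    next
      assume "q a = q b"
      then have eq: "(1 - \<phi> x / \<phi> e) / 2 + \<phi> x / \<phi> e * \<kappa> e = (1 - \<phi> y / \<phi> e') / 2 + \<phi> y / \<phi> e' * \<kappa> e'"
        and t: "\<phi> x / \<phi> e = \<phi> y / \<phi> e'"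
        unfolding a(1) b(1) q_def fst_conv snd_conv prod.inject by blast+
      show "snd a = snd b"
      proof (cases "\<phi> x = 0")
        case True
        then have "\<phi> y = 0"
          using t e_pos[OF b(2)] by simp
        then have "x = v" "y = v"
          using True \<phi>_pos L by force+
        then show ?thesis
          using a b by simp
      next
        case False
        moreover have "\<phi> x / \<phi> e * \<kappa> e = \<phi> x / \<phi> e * \<kappa> e'"
          using eq unfolding t[symmetric] by linarith
        ultimately have "\<kappa> e = \<kappa> e'"
          using e_pos[OF a(2)] by simp
        then have "e = e'"
          using \<kappa>_inj a b by blast
        then have "\<phi> x = \<phi> y"
          using t e_pos[OF a(2)] by simp
        then show ?thesis
          using \<phi>_inj[OF L(1), of x y] a b \<open>e = e'\<close> by simp
      qed
    qed
  qed
  ultimately have "snd ` W homeomorphic q ` W"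
    by (rule homeomorphic_same_fibres)
  moreover have "snd ` W = (\<Union>e\<in>K. seg e)"
    by (force simp: W_def)
  moreover have "q ` W = standard_cantor_fan"
  proof (intro equalityI subsetI)
    fix s assume "s \<in> q ` W"
    then obtain e y where ey: "e \<in> K" "y \<in> seg e" "s = q (e, y)"
      by (auto simp: W_def)
    have "0 \<le> \<phi> y"
      using \<phi>_le[of y v] top_in_seg seg_subset ey KL \<phi>v by (metis subsetD)
    moreover have "\<phi> y \<le> \<phi> e"
      using \<phi>_le ey KL by blast
    ultimately have "0 \<le> \<phi> y / \<phi> e" "\<phi> y / \<phi> e \<le> 1"
      using e_pos[OF ey(1)] by auto
    moreover have "\<kappa> e \<in> cantor_set"
      using \<kappa>_range ey(1) by blast
    ultimately show "s \<in> standard_cantor_fan"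
      unfolding standard_cantor_fan_eq ey(3) q_def by auto
  next
    fix s assume "s \<in> standard_cantor_fan"
    then obtain c u where cu: "c \<in> cantor_set" "0 \<le> u" "u \<le> 1" "s = ((1 - u) / 2 + u * c, u)"
      unfolding standard_cantor_fan_eq by auto
    obtain e where e: "e \<in> K" "c = \<kappa> e"
      using cu(1) \<kappa>_range by blast
    have eL: "e \<in> L"
      using e KL by blast
    \<comment> \<open>Surjectivity is the intermediate value theorem on a leg, along which
      \<open>\<phi>\<close> runs from 0 to \<open>\<phi> e\<close>.\<close>
    have "connected (\<phi> ` seg e)"
      using cont connected_seg[OF eL] seg_subset[OF eL]
      by (auto intro: connected_continuous_image continuous_on_subset)
    moreover have "0 \<in> \<phi> ` seg e" "\<phi> e \<in> \<phi> ` seg e"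
      using top_in_seg[OF eL] self_in_seg[OF eL] \<phi>v by force+
    moreover have "0 \<le> u * \<phi> e" "u * \<phi> e \<le> \<phi> e"
      using cu e_pos[OF e(1)] by (auto simp: mult_le_cancel_right1)
    ultimately have "u * \<phi> e \<in> \<phi> ` seg e"
      using connected_contains_Icc[of "\<phi> ` seg e" 0 "\<phi> e"] by auto
    then obtain y where y: "y \<in> seg e" "\<phi> y = u * \<phi> e"
      by auto
    then have "s = q (e, y)"
      using cu e e_pos[OF e(1)] by (simp add: q_def)
    then show "s \<in> q ` W"
      using e y by (auto simp: W_def)
  qed
  ultimately show ?thesis
    by (simp add: cantor_fan_def)
qed

lemma legs_eq: "legs L v = seg ` end_points L"
proof -
  have "end_points L \<subseteq> L"
    by (auto simp: end_points_def)
  then show ?thesis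
    unfolding legs_def using vx_segment_iff by blast
qed

text \<open>Just below \<open>e\<close> on its leg there is a point that is no end point, hence
  outside \<open>Q\<close>, but by density a limit of end points. As \<open>Q\<close> is closed, end
  points close enough to it avoid \<open>Q\<close> as well.\<close>

lemma end_points_nowhere_locally_compact:
  assumes dense: "closure (end_points L) = L"
    and e: "e \<in> end_points L" "0 < r" and Q: "compact Q" "Q \<subseteq> end_points L"
  shows "\<exists>e'\<in>end_points L. e' \<notin> Q \<and> dist e' e < r"
proof -
  have "e \<in> L" "e \<noteq> v"
    using e(1) top_not_end_point by (auto simp: end_points_def)
  then obtain g where g: "arc g" "path_image g = seg e" "seg e \<subseteq> L" "g 0 = v" "g 1 = e"
    by (rule seg_arc)
  have "continuous_on {0..1} g"
    using g(1) by (simp add: arc_def path_def)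
  then obtain d where d: "0 < d" "\<And>t. t \<in> {0..1} \<Longrightarrow> dist t 1 < d \<Longrightarrow> dist (g t) (g 1) < r"
    using e(2) unfolding continuous_on_iff by (metis atLeastAtMost_iff order_refl zero_le_one)
  \<comment> \<open>The maximum keeps \<open>t\<close> positive when \<open>d\<close> is large;
    halving \<open>d\<close> keeps \<open>t\<close> below 1 and strictly within \<open>d\<close> of
    it.\<close>
  define t where "t = max (1/2) (1 - d/2)"
  have t: "0 < t" "t < 1" "dist t 1 < d"
    using d(1) by (auto simp: t_def dist_real_def)
  have near: "dist (g t) e < r"
    using d(2)[of t] t g(5) by simp
  have "g t \<notin> end_points L" "g t \<in> L"
    using arc_interior_not_end_point[OF g(1) _ t(1,2)] in_path_image[of t g] g t by auto
  then have "g t \<in> ball e r - Q" "g t \<in> closure (end_points L)"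
    using near Q(2) dense by (auto simp: dist_commute)
  moreover have "open (ball e r - Q)"
    using Q(1) by (simp add: compact_imp_closed open_Diff)
  ultimately have "(ball e r - Q) \<inter> end_points L \<noteq> {}"
    using open_Int_closure_eq_empty by blast
  then show ?thesis
    by (auto simp: dist_commute)
qed

end

theorem mainTheorem1:
  fixes L :: "'a::metric_space set" and v :: 'a
  assumes "lelek_fan L v"
  shows "\<exists>C :: 'a set \<Rightarrow> 'a set.
           (\<forall>A\<in>legs L v. cantor_fan (C A) \<and> C A \<subseteq> L) \<and>
           (\<forall>A1\<in>legs L v. \<forall>A2\<in>legs L v. A1 \<noteq> A2 \<longrightarrow> C A1 \<inter> C A2 = {v}) \<and>
           (\<Union>A\<in>legs L v. C A) = L"
proof -
  interpret pointed_smooth_fan L v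
    using assms by unfold_locales (auto simp: lelek_fan_def)
  let ?E = "end_points L"
  have dense: "closure ?E = L"
    using assms by (simp add: lelek_fan_def)
  have EL: "?E \<subseteq> L"
    by (auto simp: end_points_def)
  obtain F :: "nat \<Rightarrow> 'a set" where F: "\<And>n. closed (F n)" "?E = L - (\<Union>n. F n)"
    using end_points_Gdelta by metis
  obtain P where P: "\<And>K. K \<in> P \<Longrightarrow> cantor_copy K" "pairwise disjnt P" "\<Union>P = ?E"
    using cantor_partition[OF compact_L F end_points_nowhere_locally_compact[OF dense]] by blast
  obtain S where S: "\<And>e. e \<in> ?E \<Longrightarrow> cantor_copy (S e)"
    "\<And>e e'. e \<in> ?E \<Longrightarrow> e' \<in> ?E \<Longrightarrow> e \<noteq> e' \<Longrightarrow> S e \<inter> S e' = {}" "(\<Union>e\<in>?E. S e) = ?E"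
    using cantor_partition_indexed_by_points[OF P] by metis
  have SE: "S e \<subseteq> ?E" if "e \<in> ?E" for e
    using S(3) that by blast
  \<comment> \<open>By maximality a leg contains only one end point, so the choice is
    forced.\<close>
  define tip where "tip A = (SOME e. e \<in> ?E \<and> seg e = A)" for A
  have tip: "tip A \<in> ?E" "seg (tip A) = A" if "A \<in> legs L v" for A
  proof -
    have "\<exists>e. e \<in> ?E \<and> seg e = A"
      using that by (auto simp: legs_eq)
    then have "tip A \<in> ?E \<and> seg (tip A) = A"
      unfolding tip_def by (rule someI_ex)
    then show "tip A \<in> ?E" "seg (tip A) = A"
      by auto
  qed
  have tip_seg: "tip (seg e) = e" if e: "e \<in> ?E" for e
  proof -
    have "seg e \<in> legs L v"
      using e by (simp add: legs_eq)
    then have "tip (seg e) \<in> ?E" "e \<in> seg (tip (seg e))"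
      using tip self_in_seg e EL by auto
    then show ?thesis
      using end_point_maximal[OF e] EL by blast
  qed
  \<comment> \<open>The leg \<open>A\<close> acts as an index only; it need not be contained in
    \<open>C A\<close>.\<close>
  define C where "C A = (\<Union>f\<in>S (tip A). seg f)" for A
  have "cantor_fan (C A) \<and> C A \<subseteq> L" if "A \<in> legs L v" for A
  proof
    show "cantor_fan (C A)"
      unfolding C_def using tip(1)[OF that] S(1) SE by (intro cantor_fan_Union_seg)
    show "C A \<subseteq> L"
      unfolding C_def using tip(1)[OF that] SE EL seg_subset by blast
  qed
  moreover have "C A \<inter> C B = {v}" if AB: "A \<in> legs L v" "B \<in> legs L v" "A \<noteq> B" for A B
  proof (intro equalityI subsetI)
    have "tip A \<noteq> tip B"
      using AB tip(2) by metis
    then have disj: "S (tip A) \<inter> S (tip B) = {}"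
      using S(2) tip(1) AB by blast
    fix x assume "x \<in> C A \<inter> C B"
    then obtain f f' where f: "f \<in> S (tip A)" "f' \<in> S (tip B)" "x \<in> seg f" "x \<in> seg f'"
      by (auto simp: C_def)
    then have "f \<in> ?E" "f' \<in> ?E" "f \<noteq> f'"
      using SE tip(1) AB disj by blast+
    then show "x \<in> {v}"
      using seg_end_points_disjoint[of f f' x] f by blast
  next
    have "v \<in> C A" if A: "A \<in> legs L v" for A
    proof -
      have "S (tip A) \<noteq> {}"
        using cantor_copy_nonempty S(1) tip(1)[OF A] by blast
      then obtain f where "f \<in> S (tip A)" "f \<in> L"
        using SE[OF tip(1)[OF A]] EL by blast
      then show ?thesis
        using top_in_seg by (auto simp: C_def)
    qed
    then show "x \<in> C A \<inter> C B" if "x \<in> {v}" for x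
      using that AB by auto
  qed
  moreover have "(\<Union>A\<in>legs L v. C A) = L"
  proof (intro equalityI subsetI)
    fix x assume "x \<in> (\<Union>A\<in>legs L v. C A)"
    then show "x \<in> L"
      using calculation(1) by blast
  next
    fix x assume "x \<in> L"
    then obtain f where f: "f \<in> ?E" "x \<in> seg f"
      by (rule end_point_above)
    then obtain e where e: "e \<in> ?E" "f \<in> S e"
      using S(3) by blast
    then have "seg e \<in> legs L v" "x \<in> C (seg e)"
      using f tip_seg[OF e(1)] by (auto simp: legs_eq C_def)
    then show "x \<in> (\<Union>A\<in>legs L v. C A)"
      by blast
  qed
  ultimately show ?thesis
    by blast
qed

end
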